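(* Every lattice $2$-zonotope of covering radius greater than $\frac12$ is unimodularly equivalent to one of the following: (1) a parallelogram of lattice-width one, generated by $\{(1,0),(0,k)\}$ for some integer $k\ge1$; (2) a parallelogram $P_{1,k}$ of lattice-width two and area $k$, for some integer $k\ge2$; (3) a hexagon of lattice-width two, with volume vector $(1,1,k)$ for some integer $k\ge1$; (4) the parallelogram $P_{2,5}$ of lattice-width three and volume $5$. In particular, every cosimple zonotope with generators in $\mathbb{Z}^2$ (with any number of generators) has covering radius at most $\frac12$.
   Context: A lattice $2$-zonotope is a two-dimensional zonotope in $\mathbb{R}^2$ that is a lattice translate of $\sum_{i}[\mathbf 0,\mathbf u_i]$ with finitely many generators $\mathbf u_i\in\mathbb{Z}^2$. The covering radius of a convex body $C\subseteq\mathbb{R}^d$ is $\mu(C)=\min\{\rho>0:\rho C+\mathbb{Z}^d=\mathbb{R}^d\}$. The lattice-width of $C$ is the minimum, over $\mathbf z\in\mathbb{Z}^d\setminus\{\mathbf 0\}$, of $\max_{\mathbf x\in C}\mathbf z^\intercal\mathbf x-\min_{\mathbf x\in C}\mathbf z^\intercal\mathbf x$. Lattice polytopes $P,Q\subseteq\mathbb{R}^d$ are unimodularly equivalent if $P=UQ+\mathbf t$ for some $U\in\mathbb{Z}^{d\times d}$ with $|\det U|=1$ and $\mathbf t\in\mathbb{Z}^d$. For integers $p,q$ put $P_{p,q}:=[\mathbf 0,(1,0)]+[\mathbf 0,(p,q)]$. For a hexagon generated by three vectors $\mathbf u_1,\mathbf u_2,\mathbf u_3\in\mathbb{Z}^2$,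 the volume vector is the triple (up to order) of areas $|\det(\mathbf u_i,\mathbf u_j)|$, $i<j$. A finite collection of vectors $\mathbf u_1,\dots,\mathbf u_n\in\mathbb{Z}^d$ that linearly spans $\mathbb{R}^d$ is cosimple if there is a linear dependence $\sum_i\lambda_i\mathbf u_i=\mathbf 0$ whose coefficients are all non-zero and have pairwise different absolute values; a cosimple zonotope is a zonotope $\sum_i[\mathbf 0,\mathbf u_i]$ generated by a cosimple collection. *)

theory Defs
  imports "HOL-Analysis.Analysis" "HOL-Library.Multiset" "HOL-Library.Set_Algebras"
begin

definition int_lattice :: "(real ^ 'n) set" where
  "int_lattice = {x. \<forall>i. x $ i \<in> \<int>}"

text \<open>A finite collection of generators (repetitions allowed) is a list; the sum below is the
  Minkowski sum of sets.\<close>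

definition zonotope :: "(real ^ 'n) list \<Rightarrow> (real ^ 'n) set" where
  "zonotope us = (\<Sum>u\<leftarrow>us. closed_segment 0 u)"

definition lattice_zonotope :: "(real ^ 'n) set \<Rightarrow> bool" where
  "lattice_zonotope Z \<longleftrightarrow>
     (\<exists>us t. set us \<subseteq> int_lattice \<and> t \<in> int_lattice \<and> Z = (\<lambda>x. x + t) ` zonotope us)"

definition lattice_2_zonotope :: "(real ^ 2) set \<Rightarrow> bool" where
  "lattice_2_zonotope Z \<longleftrightarrow> lattice_zonotope Z \<and> aff_dim Z = 2"

text \<open>For a convex body (compact, with non-empty interior) the infima in the next two definitions
  are attained, so they are the minima of the usual definitions; likewise the supremum and the
  infimum of the linear functional in the width. For other sets the values are not meaningful.\<close>

definition covering_radius :: "(real ^ 'n) set \<Rightarrow> real" where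
  "covering_radius C = Inf {\<rho>. \<rho> > 0 \<and> (\<lambda>x. \<rho> *\<^sub>R x) ` C + int_lattice = UNIV}"

definition lattice_width :: "(real ^ 'n) set \<Rightarrow> real" where
  "lattice_width C =
     (INF z\<in>int_lattice - {0}. (SUP x\<in>C. z \<bullet> x) - (INF x\<in>C. z \<bullet> x))"

definition unimodularly_equivalent :: "(real ^ 'n) set \<Rightarrow> (real ^ 'n) set \<Rightarrow> bool" where
  "unimodularly_equivalent P Q \<longleftrightarrow>
     (\<exists>(U :: real ^ 'n ^ 'n) t. (\<forall>i j. U $ i $ j \<in> \<int>) \<and> \<bar>det U\<bar> = 1 \<and> t \<in> int_lattice \<and>
        P = (\<lambda>x. U *v x + t) ` Q)"

definition P_par :: "int \<Rightarrow> int \<Rightarrow> (real ^ 2) set" where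
  "P_par p q = zonotope [vector [1, 0], vector [of_int p, of_int q]]"

definition hexagon :: "(real ^ 2) set \<Rightarrow> bool" where
  "hexagon P \<longleftrightarrow> polytope P \<and> card {v. v extreme_point_of P} = 6"

text \<open>The areas of the three parallelograms spanned by two of the generators, up to order.\<close>

definition volume_vector :: "real ^ 2 \<Rightarrow> real ^ 2 \<Rightarrow> real ^ 2 \<Rightarrow> real multiset" where
  "volume_vector u1 u2 u3 =
     {# \<bar>det (vector [u1, u2] :: real ^ 2 ^ 2)\<bar>,
        \<bar>det (vector [u1, u3] :: real ^ 2 ^ 2)\<bar>,
        \<bar>det (vector [u2, u3] :: real ^ 2 ^ 2)\<bar> #}"

definition cosimple :: "(real ^ 'n) list \<Rightarrow> bool" where
  "cosimple us \<longleftrightarrow> set us \<subseteq> int_lattice \<and> span (set us) = UNIV \<and>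
     (\<exists>c :: nat \<Rightarrow> real. (\<Sum>i<length us. c i *\<^sub>R us ! i) = 0 \<and>
        (\<forall>i<length us. c i \<noteq> 0) \<and> inj_on (\<lambda>i. \<bar>c i\<bar>) {..<length us})"

end

theory Submission
  imports Defs
begin

text \<open>A covering radius above \<open>1/2\<close> means that \<open>Z/2\<close> fails to cover the plane modulo the lattice, so
  everything reduces to recognising the generator lists whose half zonotope covers. Unimodular maps,
  sign changes of generators and deleting generators allow one to work with few explicit integer
  vectors. A non-primitive direction of total multiplicity at least two wraps around the torus, so it
  forces a covering unless the remaining generators have total height one, which is the strip of
  case (1). Otherwise all generators are primitive and pairwise independent; slicing shows that every
  pair has determinant \<open>\<plusminus>1\<close> or is equivalent to \<open>P_par 1 k\<close> or \<open>P_par 2 5\<close>. Adding a third generator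
  to \<open>P_par 2 5\<close> always produces a covering, adding one to \<open>P_par 1 k\<close> does so unless its
  determinants with both generators are \<open>\<plusminus>1\<close>. Four such generators always cover: six determinants
  \<open>\<plusminus>1\<close> would violate the Pluecker relation modulo two, and the only other candidate,
  \<open>(1,0), (1,2), (0,1), (1,1)\<close>, covers by slicing.\<close>

section \<open>Half coverings and zonotopes\<close>

text \<open>Only upper bounds on covering radii enter: a covering by half the body puts 1/2 into the
  set whose infimum is the radius, so every excluded configuration is settled by exhibiting
  coefficients in [0, 1/2], one per generator. The bound 1/2 shows in the wrap-around step, because
  half of a generator 2v is exactly one lattice period. The exception of volume 5 comes from
  counting integer height steps inside half a parallelogram: for (1,0), (2,5) up to two steps are
  needed, but the total height is 5/2, so starting heights above 1/2 fail. The non-covering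
  configurations are recorded by determinants of the given generators and not merely up to
  equivalence, because the claim on cosimple collections tests a linear dependence against these
  very generators; the normal forms are derived from the same list of cases.\<close>

definition half_covers :: "(real ^ 'n) set \<Rightarrow> bool" where
  "half_covers C \<longleftrightarrow> (\<forall>p. \<exists>x\<in>C. p - (1 / 2) *\<^sub>R x \<in> int_lattice)"

lemma int_lattice_0 [simp]: "0 \<in> int_lattice"
  and int_lattice_add: "x \<in> int_lattice \<Longrightarrow> y \<in> int_lattice \<Longrightarrow> x + y \<in> int_lattice"
  and int_lattice_minus: "x \<in> int_lattice \<Longrightarrow> - x \<in> int_lattice"
  by (auto simp: int_lattice_def)

lemma int_lattice_mult:
  fixes U :: "real ^ 'n ^ 'm"
  assumes "\<And>i j. U $ i $ j \<in> \<int>" "x \<in> int_lattice"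
  shows "U *v x \<in> int_lattice"
  using assms by (auto simp: int_lattice_def matrix_vector_mult_def intro!: Ints_sum)

lemma covering_radius_le_half:
  assumes "half_covers C"
  shows "covering_radius C \<le> 1 / 2"
proof -
  have "p \<in> (\<lambda>x. (1 / 2) *\<^sub>R x) ` C + int_lattice" for p
  proof -
    obtain x where x: "x \<in> C" "p - (1 / 2) *\<^sub>R x \<in> int_lattice"
      using assms by (auto simp: half_covers_def)
    then have "(1 / 2) *\<^sub>R x + (p - (1 / 2) *\<^sub>R x) \<in> (\<lambda>x. (1 / 2) *\<^sub>R x) ` C + int_lattice"
      by (intro set_plus_intro) auto
    then show ?thesis by simp
  qed
  then have "1 / 2 \<in> {\<rho>. \<rho> > 0 \<and> (\<lambda>x. \<rho> *\<^sub>R x) ` C + int_lattice = UNIV}"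
    by auto
  then show ?thesis
    unfolding covering_radius_def by (intro cInf_lower bdd_belowI[of _ 0]) auto
qed

lemma half_covers_mono: "half_covers C \<Longrightarrow> C \<subseteq> D \<Longrightarrow> half_covers D"
  unfolding half_covers_def by blast

text \<open>The shift \<open>t\<close> is arbitrary: the halved body moves by t/2, which may fail to
  be a lattice vector even for integral \<open>t\<close>, so the covering is applied at p -
  t/2.\<close>

lemma half_covers_translation:
  assumes "half_covers C"
  shows "half_covers ((\<lambda>x. x + t) ` C)"
  unfolding half_covers_def
proof
  fix p
  obtain x where "x \<in> C" "p - (1 / 2) *\<^sub>R t - (1 / 2) *\<^sub>R x \<in> int_lattice"
    using assms by (auto simp: half_covers_def)
  then show "\<exists>y\<in>(\<lambda>x. x + t) ` C. p - (1 / 2) *\<^sub>R y \<in> int_lattice"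
    by (auto simp: algebra_simps)
qed

text \<open>Pull the point back by the inverse \<open>V\<close>; the integral matrix
  \<open>U\<close> then carries the lattice difference forward to a lattice difference.\<close>

lemma half_covers_unimodular:
  assumes "unimodularly_equivalent P Q" "half_covers Q"
  shows "half_covers P"
proof -
  obtain U :: "real ^ 'a ^ 'a" and t where U: "\<And>i j. U $ i $ j \<in> \<int>" "\<bar>det U\<bar> = 1"
    and P: "P = (\<lambda>x. U *v x + t) ` Q"
    using assms(1) by (auto simp: unimodularly_equivalent_def)
  have "invertible U" using U(2) by (auto simp: invertible_det_nz)
  then obtain V where V: "U ** V = mat 1" by (auto simp: invertible_def)
  have "half_covers ((\<lambda>x. U *v x) ` Q)"
    unfolding half_covers_def
  proof
    fix p
    obtain x where x: "x \<in> Q" "V *v p - (1 / 2) *\<^sub>R x \<in> int_lattice"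
      using assms(2) by (auto simp: half_covers_def)
    have "U *v (V *v p - (1 / 2) *\<^sub>R x) = p - (1 / 2) *\<^sub>R (U *v x)"
      using V
      by (simp add: matrix_vector_mult_diff_distrib matrix_vector_mul_assoc matrix_vector_mult_scaleR)
    with int_lattice_mult[OF U(1) x(2)] x(1)
    show "\<exists>y\<in>(\<lambda>x. U *v x) ` Q. p - (1 / 2) *\<^sub>R y \<in> int_lattice" by auto
  qed
  from half_covers_translation[OF this, of t] show ?thesis
    by (simp add: P image_image)
qed

lemma unimodularly_equivalent_trans:
  assumes "unimodularly_equivalent P Q" "unimodularly_equivalent Q R"
  shows "unimodularly_equivalent P R"
proof -
  obtain U :: "real ^ 'a ^ 'a" and t where U: "\<And>i j. U $ i $ j \<in> \<int>" "\<bar>det U\<bar> = 1" "t \<in> int_lattice"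
    and P: "P = (\<lambda>x. U *v x + t) ` Q"
    using assms(1) by (auto simp: unimodularly_equivalent_def)
  obtain V :: "real ^ 'a ^ 'a" and s where V: "\<And>i j. V $ i $ j \<in> \<int>" "\<bar>det V\<bar> = 1" "s \<in> int_lattice"
    and Q: "Q = (\<lambda>x. V *v x + s) ` R"
    using assms(2) by (auto simp: unimodularly_equivalent_def)
  have "P = (\<lambda>x. (U ** V) *v x + (U *v s + t)) ` R"
    by (simp add: P Q image_image matrix_vector_mul_assoc[symmetric] matrix_vector_right_distrib add.assoc)
  moreover have "(U ** V) $ i $ j \<in> \<int>" for i j
    using U(1) V(1) by (auto simp: matrix_matrix_mult_def)
  moreover have "\<bar>det (U ** V)\<bar> = 1" using U(2) V(2) by (simp add: det_mul abs_mult)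
  moreover have "U *v s + t \<in> int_lattice"
    using int_lattice_mult[OF U(1) V(3)] U(3) by (rule int_lattice_add)
  ultimately show ?thesis unfolding unimodularly_equivalent_def by blast
qed

lemma unimodularly_equivalent_translation:
  assumes "t \<in> int_lattice"
  shows "unimodularly_equivalent ((\<lambda>x. x + t) ` Q) Q"
  unfolding unimodularly_equivalent_def
  by (rule exI[of _ "mat 1"], rule exI[of _ t]) (use assms in \<open>simp add: matrix_vector_mul_lid, simp add: mat_def\<close>)

section \<open>Minkowski sums of segments\<close>

lemma zonotope_Nil [simp]: "zonotope [] = {0}"
  by (simp add: zonotope_def)

lemma zonotope_Cons: "zonotope (u # us) = closed_segment 0 u + zonotope us"
  by (simp add: zonotope_def)

lemma zonotope_append: "zonotope (us @ vs) = zonotope us + zonotope vs"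
  by (simp add: zonotope_def)

lemma zonotope_mset: "mset us = mset vs \<Longrightarrow> zonotope us = zonotope vs"
  unfolding zonotope_def by (metis mset_map sum_mset_sum_list)

lemma zero_in_zonotope: "0 \<in> zonotope us"
proof (induction us)
  case (Cons u us)
  then show ?case
    using set_plus_intro[of 0 "closed_segment 0 u" 0 "zonotope us"] by (simp add: zonotope_Cons)
qed simp

text \<open>The segments left out can all contribute 0. This is why a covering by a sublist of the
  generators suffices.\<close>

lemma zonotope_mono:
  assumes "mset vs \<subseteq># mset us"
  shows "zonotope vs \<subseteq> zonotope us"
proof -
  obtain ws where "mset ws = mset us - mset vs" using ex_mset by blast
  then have "mset us = mset (vs @ ws)" using assms by simp
  then have "zonotope us = zonotope vs + zonotope ws"
    using zonotope_mset zonotope_append by metis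
  then show ?thesis
    using zero_in_zonotope[of ws] set_plus_intro[of _ "zonotope vs" 0] by fastforce
qed

lemma closed_segment_0: "closed_segment 0 u = {t *\<^sub>R u | t. 0 \<le> t \<and> t \<le> 1}"
  by (auto simp: closed_segment_def)

lemma zonotope_ConsE:
  assumes "x \<in> zonotope (u # us)"
  obtains t y where "0 \<le> t" "t \<le> 1" "y \<in> zonotope us" "x = t *\<^sub>R u + y"
  using assms by (auto simp: zonotope_Cons closed_segment_0 elim!: set_plus_elim)

lemma zonotope_ConsI:
  assumes "0 \<le> t" "t \<le> 1" "y \<in> zonotope us"
  shows "t *\<^sub>R u + y \<in> zonotope (u # us)"
  using assms by (auto simp: zonotope_Cons closed_segment_0 intro!: set_plus_intro)

lemma zonotope_linear_image:
  assumes "linear f"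
  shows "zonotope (map f us) = f ` zonotope us"
proof (induction us)
  case (Cons u us)
  have "f ` (A + B) = f ` A + f ` B" for A B
    using assms by (force simp: set_plus_def image_iff linear_add)
  then show ?case
    using Cons closed_segment_linear_image[OF assms, of 0 u] linear_0[OF assms]
    by (simp add: zonotope_Cons)
qed (simp add: linear_0[OF assms])

lemma translation_set_plus:
  fixes A B :: "'a::ab_group_add set"
  shows "(\<lambda>x. x + s) ` A + (\<lambda>x. x + t) ` B = (\<lambda>x. x + (s + t)) ` (A + B)"
proof -
  have "a + s + (b + t) = a + b + (s + t)" for a b :: 'a by simp
  then show ?thesis by (fastforce simp: set_plus_def image_iff)
qed

lemma closed_segment_0_minus: "closed_segment 0 (- u) = (\<lambda>x. x + (- u)) ` closed_segment 0 u"
proof -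
  have "closed_segment 0 (- u) = (+) (- u) ` closed_segment u 0"
    using closed_segment_translation[of "- u" u 0] by simp
  then show ?thesis by (simp add: closed_segment_commute add.commute[of "- u"])
qed

text \<open>Since [0,-u] = [0,u] - u, each sign change costs a translation by a generator, which is
  a lattice vector.\<close>

lemma zonotope_flip:
  assumes "list_all2 (\<lambda>u v. u = v \<or> u = - v) us vs" "set vs \<subseteq> int_lattice"
  shows "\<exists>t\<in>int_lattice. zonotope us = (\<lambda>x. x + t) ` zonotope vs"
  using assms
proof (induction rule: list_all2_induct)
  case Nil
  show ?case by (rule bexI[of _ 0]) auto
next
  case (Cons u us v vs)
  then obtain t where t: "t \<in> int_lattice" "zonotope us = (\<lambda>x. x + t) ` zonotope vs" by auto
  obtain s where s: "s \<in> int_lattice" "closed_segment 0 u = (\<lambda>x. x + s) ` closed_segment 0 v"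
  proof (cases "u = v")
    case True
    then show ?thesis by (intro that[of 0]) auto
  next
    case False
    then show ?thesis
      using Cons closed_segment_0_minus[of v] by (intro that[of "- v"]) (auto intro: int_lattice_minus)
  qed
  show ?case
    using s t by (intro bexI[of _ "s + t"])
      (auto simp: zonotope_Cons translation_set_plus intro: int_lattice_add)
qed

text \<open>Merges generators on a common ray: it turns a repeated primitive generator into its
  double, and later a stack of vertical generators into one.\<close>

lemma zonotope_scaled:
  assumes "0 \<le> a" "0 \<le> b"
  shows "zonotope (a *\<^sub>R v # b *\<^sub>R v # us) = zonotope ((a + b) *\<^sub>R v # us)"
proof -
  have "closed_segment 0 (a *\<^sub>R v) + closed_segment 0 (b *\<^sub>R v) = closed_segment 0 ((a + b) *\<^sub>R v)"
    (is "?A + ?B = ?C")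
  proof
    show "?A + ?B \<subseteq> ?C"
    proof
      fix x assume "x \<in> ?A + ?B"
      then obtain s t where st: "0 \<le> s" "s \<le> 1" "0 \<le> t" "t \<le> 1" and x: "x = s *\<^sub>R a *\<^sub>R v + t *\<^sub>R b *\<^sub>R v"
        by (auto simp: closed_segment_0 elim!: set_plus_elim)
      let ?r = "(s * a + t * b) / (a + b)"
      have *: "0 \<le> s * a + t * b" "s * a + t * b \<le> a + b"
        using assms st by (auto intro!: add_mono mult_left_le_one_le)
      \<comment> \<open>If a + b = 0, the quotient \<open>?r\<close> is 0 by convention and the
        bounds just shown force the numerator to vanish.\<close>
      then have "?r * (a + b) = s * a + t * b" by (cases "a + b = 0") auto
      then have "x = ?r *\<^sub>R (a + b) *\<^sub>R v" by (simp add: x scaleR_left_distrib[symmetric])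
      moreover have "0 \<le> ?r" "?r \<le> 1" using * assms by (auto simp: divide_le_eq_1)
      ultimately show "x \<in> ?C" unfolding closed_segment_0 by blast
    qed
    show "?C \<subseteq> ?A + ?B"
    proof
      fix x assume "x \<in> ?C"
      then obtain t where "0 \<le> t" "t \<le> 1" "x = t *\<^sub>R a *\<^sub>R v + t *\<^sub>R b *\<^sub>R v"
        by (auto simp: closed_segment_0 algebra_simps)
      then show "x \<in> ?A + ?B" by (auto simp: closed_segment_0 intro!: set_plus_intro)
    qed
  qed
  then show ?thesis by (simp add: zonotope_Cons add.assoc[symmetric])
qed

section \<open>Integer generators in the plane\<close>

text \<open>Generators are kept as integer pairs, so that determinants, case splits and changes of
  basis are integer arithmetic; \<open>ivec\<close> is the passage to the plane.\<close>

definition ivec :: "int \<times> int \<Rightarrow> real ^ 2" where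
  "ivec x = vector [of_int (fst x), of_int (snd x)]"

definition idet :: "int \<times> int \<Rightarrow> int \<times> int \<Rightarrow> int" where
  "idet x y = fst x * snd y - snd x * fst y"

definition iscale :: "int \<Rightarrow> int \<times> int \<Rightarrow> int \<times> int" where
  "iscale c x = (c * fst x, c * snd x)"

definition primitive :: "int \<times> int \<Rightarrow> bool" where
  "primitive x \<longleftrightarrow> coprime (fst x) (snd x)"

abbreviation izon :: "(int \<times> int) list \<Rightarrow> (real ^ 2) set" where
  "izon xs \<equiv> zonotope (map ivec xs)"

abbreviation same_up_to_sign :: "(int \<times> int) list \<Rightarrow> (int \<times> int) list \<Rightarrow> bool" where
  "same_up_to_sign \<equiv> list_all2 (\<lambda>x y. x = y \<or> x = - y)"

lemma ivec_nth [simp]: "ivec x $ 1 = of_int (fst x)" "ivec x $ 2 = of_int (snd x)"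
  by (auto simp: ivec_def)

lemma ivec_eq_iff: "ivec x = ivec y \<longleftrightarrow> x = y"
  by (auto simp: vec_eq_iff forall_2 prod_eq_iff)

lemma ivec_add: "ivec (x + y) = ivec x + ivec y"
  and ivec_minus: "ivec (- x) = - ivec x"
  and ivec_0: "ivec 0 = 0"
  and ivec_iscale: "ivec (iscale c x) = of_int c *\<^sub>R ivec x"
  by (auto simp: vec_eq_iff forall_2 iscale_def)

lemma int_lattice_2: "int_lattice = range ivec"
proof
  show "int_lattice \<subseteq> range ivec"
  proof
    fix x :: "real ^ 2" assume "x \<in> int_lattice"
    then have "x $ 1 \<in> \<int>" "x $ 2 \<in> \<int>" by (auto simp: int_lattice_def)
    then obtain a b where "x $ 1 = of_int a" "x $ 2 = of_int b" by (meson Ints_cases)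
    then have "x = ivec (a, b)" by (auto simp: vec_eq_iff forall_2)
    then show "x \<in> range ivec" by blast
  qed
qed (auto simp: int_lattice_def forall_2)

lemma idet_simps [simp]:
  "idet x x = 0" "idet 0 x = 0" "idet x 0 = 0" "idet (- x) y = - idet x y" "idet x (- y) = - idet x y"
  "idet (x + y) z = idet x z + idet y z" "idet z (x + y) = idet z x + idet z y"
  "idet (iscale c x) y = c * idet x y" "idet x (iscale c y) = c * idet x y"
  by (auto simp: idet_def iscale_def algebra_simps)

lemma idet_commute: "idet y x = - idet x y"
  by (simp add: idet_def)

lemma primitive_basis:
  assumes "primitive v"
  shows "\<exists>w. idet v w = 1"
proof -
  obtain a b where "a * fst v + b * snd v = 1"
    using bezout_int[of "fst v" "snd v"] assms by (auto simp: primitive_def coprime_iff_gcd_eq_1)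
  then have "idet v (- b, a) = 1" by (simp add: idet_def algebra_simps)
  then show ?thesis ..
qed

text \<open>Coordinates with respect to the lattice basis \<open>b1, b2\<close>, by Cramer's rule;
  the determinant \<open>idet b1 b2\<close> is its own inverse.\<close>

definition coord :: "int \<times> int \<Rightarrow> int \<times> int \<Rightarrow> int \<times> int \<Rightarrow> int \<times> int" where
  "coord b1 b2 x = (idet b1 b2 * idet x b2, idet b1 b2 * idet b1 x)"

lemma coord_inverse:
  assumes "\<bar>idet b1 b2\<bar> = 1"
  shows "iscale (fst (coord b1 b2 x)) b1 + iscale (snd (coord b1 b2 x)) b2 = x"
proof -
  have 1: "idet b1 b2 * idet b1 b2 = 1" using assms by (auto simp: abs_eq_iff')
  have "idet x b2 * fst b1 + idet b1 x * fst b2 = idet b1 b2 * fst x"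
    "idet x b2 * snd b1 + idet b1 x * snd b2 = idet b1 b2 * snd x"
    by (auto simp: idet_def algebra_simps)
  then have "idet b1 b2 * (idet x b2 * fst b1 + idet b1 x * fst b2) = fst x"
    "idet b1 b2 * (idet x b2 * snd b1 + idet b1 x * snd b2) = snd x"
    using 1 by (simp_all add: mult.assoc[symmetric])
  then show ?thesis by (simp add: coord_def iscale_def prod_eq_iff algebra_simps)
qed

text \<open>The matrix with columns \<open>b1\<close>, \<open>b2\<close> sends the coordinates of a
  vector back to the vector.\<close>

lemma unimodularly_equivalent_coord:
  assumes "\<bar>idet b1 b2\<bar> = 1"
  shows "unimodularly_equivalent (izon xs) (izon (map (coord b1 b2) xs))"
proof -
  define U :: "real ^ 2 ^ 2" where
    "U = vector [vector [of_int (fst b1), of_int (fst b2)], vector [of_int (snd b1), of_int (snd b2)]]"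
  have U_ivec: "U *v ivec (m, n) = ivec (iscale m b1 + iscale n b2)" for m n
    by (simp add: vec_eq_iff forall_2 U_def matrix_vector_mult_def sum_2 iscale_def mult.commute)
  have "U *v ivec (coord b1 b2 x) = ivec x" for x
    using U_ivec[of "fst (coord b1 b2 x)" "snd (coord b1 b2 x)"] coord_inverse[OF assms, of x] by simp
  then have "map ivec xs = map ((*v) U) (map ivec (map (coord b1 b2) xs))" by simp
  then have "izon xs = (\<lambda>x. U *v x) ` izon (map (coord b1 b2) xs)"
    using zonotope_linear_image[of "(*v) U"] by (metis matrix_vector_mul_linear)
  moreover have "U $ i $ j \<in> \<int>" for i j
    using exhaust_2[of i] exhaust_2[of j] by (auto simp: U_def)
  moreover have "det U = of_int (idet b1 b2)"
    by (simp add: det_2 U_def idet_def)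
  then have "\<bar>det U\<bar> = 1" using assms by (metis of_int_1 of_int_abs)
  ultimately show ?thesis
    unfolding unimodularly_equivalent_def by (intro exI[of _ U] exI[of _ 0]) auto
qed

lemma unimodularly_equivalent_sign:
  assumes "same_up_to_sign xs ys"
  shows "unimodularly_equivalent (izon xs) (izon ys)"
proof -
  have "list_all2 (\<lambda>u v. u = v \<or> u = - v) (map ivec xs) (map ivec ys)"
    using assms by (auto simp: list_all2_conv_all_nth ivec_minus)
  moreover have "set (map ivec ys) \<subseteq> int_lattice" by (auto simp: int_lattice_2)
  ultimately obtain t where t: "t \<in> int_lattice" "izon xs = (\<lambda>x. x + t) ` izon ys"
    by (auto dest!: zonotope_flip)
  show ?thesis unfolding t(2) by (rule unimodularly_equivalent_translation[OF t(1)])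
qed

lemma izon_mset: "mset xs = mset ys \<Longrightarrow> izon xs = izon ys"
  by (intro zonotope_mset) simp

lemma half_covers_izon_mono:
  assumes "half_covers (izon ys)" "mset ys \<subseteq># mset xs"
  shows "half_covers (izon xs)"
  using assms(1)
proof (rule half_covers_mono)
  show "izon ys \<subseteq> izon xs"
    using image_mset_subseteq_mono[OF assms(2)] by (intro zonotope_mono) simp
qed

text \<open>The common pattern of all later covering proofs: choose a lattice basis, compute
  coordinates, correct signs, and quote an explicit list that covers.\<close>

lemma half_covers_coord:
  assumes "\<bar>idet b1 b2\<bar> = 1" "same_up_to_sign (map (coord b1 b2) xs) ys" "half_covers (izon ys)"
  shows "half_covers (izon xs)"
  using half_covers_unimodular[OF unimodularly_equivalent_sign[OF assms(2)] assms(3)]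
  by (rule half_covers_unimodular[OF unimodularly_equivalent_coord[OF assms(1)]])

text \<open>The point (X, Y) lies in half the zonotope modulo the lattice. The factor 1/2 is
  absorbed into the range of the coefficients, and the recursion on the list lets a proof supply
  them generator by generator as real numbers.\<close>

primrec reaches :: "(int \<times> int) list \<Rightarrow> real \<Rightarrow> real \<Rightarrow> bool" where
  "reaches [] X Y \<longleftrightarrow> X \<in> \<int> \<and> Y \<in> \<int>"
| "reaches (x # xs) X Y \<longleftrightarrow>
     (\<exists>t. 0 \<le> t \<and> t \<le> 1 / 2 \<and> reaches xs (X - t * of_int (fst x)) (Y - t * of_int (snd x)))"

lemma reaches_imp:
  "reaches xs (p $ 1) (p $ 2) \<Longrightarrow> \<exists>x\<in>izon xs. p - (1 / 2) *\<^sub>R x \<in> int_lattice"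
proof (induction xs arbitrary: p)
  case Nil
  then show ?case by (simp add: int_lattice_def forall_2)
next
  case (Cons x xs)
  then obtain t where t: "0 \<le> t" "t \<le> 1 / 2"
    "reaches xs ((p - t *\<^sub>R ivec x) $ 1) ((p - t *\<^sub>R ivec x) $ 2)" by auto
  from Cons.IH[OF t(3)] obtain y where y: "y \<in> izon xs"
    "p - t *\<^sub>R ivec x - (1 / 2) *\<^sub>R y \<in> int_lattice" by auto
  then have "(2 * t) *\<^sub>R ivec x + y \<in> izon (x # xs)"
    using t by (auto intro: zonotope_ConsI)
  moreover have "p - (1 / 2) *\<^sub>R ((2 * t) *\<^sub>R ivec x + y) = p - t *\<^sub>R ivec x - (1 / 2) *\<^sub>R y"
    by (simp add: algebra_simps)
  ultimately show ?case using y(2) by metis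
qed

lemma half_coversI: "(\<And>X Y. reaches xs X Y) \<Longrightarrow> half_covers (izon xs)"
  unfolding half_covers_def by (blast intro: reaches_imp)

section \<open>Coverings by small zonotopes\<close>

lemma reaches_shift:
  "reaches xs X Y \<Longrightarrow> m \<in> \<int> \<Longrightarrow> n \<in> \<int> \<Longrightarrow> reaches xs (X + m) (Y + n)"
proof (induction xs arbitrary: X Y)
  case (Cons x xs)
  then obtain t where "0 \<le> t" "t \<le> 1 / 2"
    "reaches xs (X - t * of_int (fst x)) (Y - t * of_int (snd x))" by auto
  with Cons.IH[OF this(3) Cons.prems(2,3)] show ?case
    by (auto simp: algebra_simps intro!: exI[of _ t])
qed simp

lemma half_coversI_frac:
  assumes "\<And>X Y. 0 \<le> X \<Longrightarrow> X < 1 \<Longrightarrow> 0 \<le> Y \<Longrightarrow> Y < 1 \<Longrightarrow> reaches xs X Y"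
  shows "half_covers (izon xs)"
proof (rule half_coversI)
  fix X Y :: real
  have "reaches xs (frac X) (frac Y)" by (intro assms) (auto simp: frac_lt_1)
  from reaches_shift[OF this, of "of_int \<lfloor>X\<rfloor>" "of_int \<lfloor>Y\<rfloor>"] show "reaches xs X Y"
    by (simp add: frac_def)
qed

lemma reaches_ConsI:
  assumes "0 \<le> t" "t \<le> 1 / 2" "reaches xs (X - t * of_int a) (Y - t * of_int b)"
  shows "reaches ((a, b) # xs) X Y"
  using assms by auto

lemma reaches_2:
  assumes "0 \<le> t" "t \<le> 1 / 2" "0 \<le> s" "s \<le> 1 / 2"
    "X - (t * of_int a + s * of_int c) \<in> \<int>" "Y - (t * of_int b + s * of_int d) \<in> \<int>"
  shows "reaches [(a, b), (c, d)] X Y"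
  using assms by (intro reaches_ConsI[of t, OF _ _ reaches_ConsI[of s]]) (auto simp: algebra_simps)

lemma reaches_3:
  assumes "0 \<le> t" "t \<le> 1 / 2" "0 \<le> s" "s \<le> 1 / 2" "0 \<le> r" "r \<le> 1 / 2"
    "X - (t * of_int a + s * of_int c + r * of_int e) \<in> \<int>"
    "Y - (t * of_int b + s * of_int d + r * of_int f) \<in> \<int>"
  shows "reaches [(a, b), (c, d), (e, f)] X Y"
  using assms by (intro reaches_ConsI[of t, OF _ _ reaches_2[of s r]]) (auto simp: algebra_simps)

lemma reaches_4:
  assumes "0 \<le> t" "t \<le> 1 / 2" "0 \<le> s" "s \<le> 1 / 2" "0 \<le> r" "r \<le> 1 / 2" "0 \<le> q" "q \<le> 1 / 2"
    "X - (t * of_int a + s * of_int c + r * of_int e + q * of_int g) \<in> \<int>"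
    "Y - (t * of_int b + s * of_int d + r * of_int f + q * of_int h) \<in> \<int>"
  shows "reaches [(a, b), (c, d), (e, f), (g, h)] X Y"
  using assms by (intro reaches_ConsI[of t, OF _ _ reaches_3[of s r q]]) (auto simp: algebra_simps)

text \<open>The heights of the halved zonotope fill the whole interval between the sums of its
  negative and positive contributions. The induction spends only as much of each generator as is
  needed for the remaining height to fit the remaining list.\<close>

lemma reaches_height:
  assumes "(\<Sum>x\<leftarrow>xs. of_int (min 0 (snd x))) / 2 \<le> Y" "Y \<le> (\<Sum>x\<leftarrow>xs. of_int (max 0 (snd x))) / 2"
  shows "\<exists>X. reaches xs X Y"
  using assms
proof (induction xs arbitrary: Y)
  case Nil
  then show ?case by (auto intro!: exI[of _ 0])
next
  case (Cons x xs)
  define lo where "lo = (\<Sum>x\<leftarrow>xs. real_of_int (min 0 (snd x))) / 2"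
  define up where "up = (\<Sum>x\<leftarrow>xs. real_of_int (max 0 (snd x))) / 2"
  have "(\<Sum>x\<leftarrow>xs. real_of_int (min 0 (snd x))) \<le> (\<Sum>x\<leftarrow>xs. real_of_int (max 0 (snd x)))"
    by (rule sum_list_mono) auto
  then have "lo \<le> up" by (simp add: lo_def up_def)
  have Y: "real_of_int (min 0 (snd x)) / 2 + lo \<le> Y" "Y \<le> real_of_int (max 0 (snd x)) / 2 + up"
    using Cons.prems by (auto simp: lo_def up_def add_divide_distrib)
  have "\<exists>t. 0 \<le> t \<and> t \<le> 1 / 2 \<and> lo \<le> Y - t * of_int (snd x) \<and> Y - t * of_int (snd x) \<le> up"
  proof -
    consider "lo \<le> Y" "Y \<le> up" | "Y > up" | "Y < lo" by linarith
    then show ?thesis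
    proof cases
      case 1
      then show ?thesis by (intro exI[of _ 0]) auto
    next
      case 2
      \<comment> \<open>Above the range of the remaining list: \<open>t\<close> is chosen so that
        the remaining height is exactly \<open>up\<close>; the next case is symmetric with
        \<open>lo\<close>.\<close>
      then have "snd x > 0" using Y(2) by (cases "snd x > 0") auto
      then show ?thesis using 2 Y \<open>lo \<le> up\<close>
        by (intro exI[of _ "(Y - up) / of_int (snd x)"]) (auto simp: field_simps)
    next
      case 3
      then have "snd x < 0" using Y(1) by (cases "snd x < 0") auto
      then show ?thesis using 3 Y \<open>lo \<le> up\<close>
        by (intro exI[of _ "(Y - lo) / of_int (snd x)"]) (auto simp: field_simps)
    qed
  qed
  then obtain t where t: "0 \<le> t" "t \<le> 1 / 2" "lo \<le> Y - t * of_int (snd x)" "Y - t * of_int (snd x) \<le> up"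
    by blast
  with Cons.IH[of "Y - t * of_int (snd x)"] obtain X
    where "reaches xs X (Y - t * of_int (snd x))" by (auto simp: lo_def up_def)
  then have "reaches (x # xs) (X + t * of_int (fst x)) Y" using t by auto
  then show ?case ..
qed

text \<open>Half of (m, 0) has length |m|/2 >= 1 and therefore covers a full horizontal circle. The
  other generators only have to reach each height modulo 1, and their heights fill an interval of
  length half the sum, hence at least 1.\<close>

lemma half_covers_long_generator:
  assumes "\<bar>m\<bar> \<ge> 2" "(\<Sum>x\<leftarrow>xs. \<bar>snd x\<bar>) \<ge> 2"
  shows "half_covers (izon ((m, 0) # xs))"
proof (rule half_coversI)
  fix X Y :: real
  define lo where "lo = (\<Sum>x\<leftarrow>xs. real_of_int (min 0 (snd x))) / 2"
  define up where "up = (\<Sum>x\<leftarrow>xs. real_of_int (max 0 (snd x))) / 2"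
  have "(\<Sum>x\<leftarrow>xs. real_of_int (max 0 (snd x))) - (\<Sum>x\<leftarrow>xs. real_of_int (min 0 (snd x))) =
      real_of_int (\<Sum>x\<leftarrow>xs. \<bar>snd x\<bar>)"
    by (induction xs) auto
  then have "real_of_int (\<Sum>x\<leftarrow>xs. \<bar>snd x\<bar>) = 2 * (up - lo)"
    by (simp add: lo_def up_def)
  moreover have "real_of_int (\<Sum>x\<leftarrow>xs. \<bar>snd x\<bar>) \<ge> of_int 2"
    using assms(2) by (subst of_int_le_iff)
  ultimately have "up - lo \<ge> 1" by simp
  \<comment> \<open>The smallest integer lift of \<open>Y\<close> that is at least
    \<open>lo\<close>; the interval has length at least 1, so the lift stays below
    \<open>up\<close>.\<close>
  define n where "n = \<lceil>lo - Y\<rceil>"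
  have "lo \<le> Y + of_int n" "Y + of_int n \<le> up"
    using \<open>up - lo \<ge> 1\<close> unfolding n_def by linarith+
  then obtain X0 where X0: "reaches xs X0 (Y + of_int n)"
    using reaches_height[of xs] unfolding lo_def up_def by blast
  \<comment> \<open>The horizontal error is needed modulo 1 only. Its representative in [0, 1) in
    the direction of (m, 0) costs less than 1, and |m|/2 is available.\<close>
  define t where "t = frac (sgn m * (X - X0)) / of_int \<bar>m\<bar>"
  have m: "real_of_int \<bar>m\<bar> \<ge> 2" using assms(1) by linarith
  have "0 \<le> t" using m by (simp add: t_def)
  have "frac (sgn m * (X - X0)) \<le> of_int \<bar>m\<bar> / 2"
    using m frac_lt_1[of "sgn m * (X - X0)"] by linarith
  then have "t \<le> 1 / 2" using m by (simp add: t_def field_simps)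
  have "X0 - (X - t * of_int m) \<in> \<int>"
  proof (cases "m > 0")
    case True
    then show ?thesis by (simp add: t_def frac_def)
  next
    case False
    then have "t * of_int m = - frac (X0 - X)" using assms(1) by (auto simp: t_def)
    then show ?thesis by (simp add: frac_def)
  qed
  then have "X - t * of_int m - X0 \<in> \<int>" by (metis Ints_minus minus_diff_eq)
  from reaches_shift[OF X0 this, of "- of_int n"]
  have "reaches xs (X - t * of_int m) Y" by simp
  then show "reaches ((m, 0) # xs) X Y" using \<open>0 \<le> t\<close> \<open>t \<le> 1 / 2\<close> by auto
qed

text \<open>At height h the halved parallelogram is the segment from p h/q to p h/q + 1/2. Raising
  the height by 1 shifts this slice by p/q <= 1/2, so consecutive slices overlap. With
  \<open>z\<close> the offset of the point from the slice at height \<open>Y\<close>, one needs a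
  number of steps \<open>j\<close> with p j/q <= z <= p j/q + 1/2 and Y + j <= q/2; the condition q
  >= 6 leaves room for enough steps.\<close>

lemma half_covers_parallelogram:
  assumes "2 \<le> p" "2 * p \<le> q" "6 \<le> q"
  shows "half_covers (izon [(1, 0), (p, q)])"
proof (rule half_coversI_frac)
  fix X Y :: real assume Y: "0 \<le> Y" "Y < 1"
  have pq: "real_of_int p \<ge> 2" "2 * real_of_int p \<le> of_int q" "real_of_int q \<ge> 6"
    using assms by linarith+
  define z where "z = frac (X - of_int p * Y / of_int q)"
  have z: "0 \<le> z" "z < 1" by (simp_all add: z_def frac_lt_1)
  obtain j :: int where j: "0 \<le> j" "of_int p * of_int j / of_int q \<le> z"
    "z \<le> 1 / 2 + of_int p * of_int j / of_int q" "Y + of_int j \<le> of_int q / 2"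
  proof (cases "z \<le> 1 / 2")
    case True
    then show ?thesis using z Y pq by (intro that[of 0]) auto
  next
    case False
    \<comment> \<open>The real number of steps that brings the right end of the slice exactly to
      \<open>z\<close>; it is rounded up below.\<close>
    define w where "w = (z - 1 / 2) * of_int q / of_int p"
    have "w > 0" using False pq by (simp add: w_def)
    have w: "w * of_int p / of_int q = z - 1 / 2" using pq by (simp add: w_def)
    have "w < of_int q / 4"
    proof -
      have "(z - 1 / 2) * of_int q < (1 / 2) * of_int q" using z pq by (intro mult_strict_right_mono) auto
      also have "\<dots> \<le> of_int q / 4 * of_int p" using pq by simp
      finally show ?thesis using pq by (simp add: w_def divide_less_eq)
    qed
    show ?thesis
    proof (rule that[of "\<lceil>w\<rceil>"])
      show "0 \<le> \<lceil>w\<rceil>" using \<open>w > 0\<close> by linarith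
      have "of_int \<lceil>w\<rceil> * of_int p / of_int q \<le> (w + 1) * (of_int p / of_int q :: real)"
        using pq by (simp add: divide_right_mono mult_right_mono)
      also have "\<dots> = z - 1 / 2 + of_int p / of_int q"
        using w by (simp add: algebra_simps add_divide_distrib)
      also have "\<dots> \<le> z" using pq by (simp add: field_simps)
      finally show "of_int p * of_int \<lceil>w\<rceil> / of_int q \<le> z" by (simp add: mult.commute)
      have "w * of_int p / of_int q \<le> of_int \<lceil>w\<rceil> * of_int p / of_int q"
        using pq by (intro divide_right_mono mult_right_mono) auto
      then show "z \<le> 1 / 2 + of_int p * of_int \<lceil>w\<rceil> / of_int q" using w by (simp add: mult.commute)
      show "Y + of_int \<lceil>w\<rceil> \<le> of_int q / 2"
      \<comment> \<open>Rounding up and \<open>Y\<close> each cost less than 1, so w < q/4 suffices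
        once q/4 + 2 <= q/2. For q = 6 and q = 7 at most two steps occur, and Y + 2 < 3 <=
        q/2.\<close>
      proof (cases "q \<ge> 8")
        case True
        then have "real_of_int q \<ge> 8" by linarith
        then show ?thesis using Y \<open>w < of_int q / 4\<close> by linarith
      next
        case False
        then have "real_of_int q \<le> 7" by linarith
        then have "\<lceil>w\<rceil> \<le> 2" using \<open>w < of_int q / 4\<close> by linarith
        then show ?thesis using Y pq by linarith
      qed
    qed
  qed
  have "Y + real_of_int j \<ge> 0" using j(1) Y by simp
  show "reaches [(1, 0), (p, q)] X Y"
  proof (rule reaches_2[of "z - of_int p * of_int j / of_int q" "(Y + of_int j) / of_int q"])
    show "X - ((z - of_int p * of_int j / of_int q) * of_int 1 + (Y + of_int j) / of_int q * of_int p) \<in> \<int>"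
      by (simp add: z_def frac_def algebra_simps add_divide_distrib)
    show "Y - ((z - of_int p * of_int j / of_int q) * of_int 0 + (Y + of_int j) / of_int q * of_int q) \<in> \<int>"
      using pq by simp
  qed (use j pq \<open>Y + real_of_int j \<ge> 0\<close> in \<open>auto simp: field_simps\<close>)
qed

text \<open>The third generator lowers the height to at most 1/2. Then the steps 0, 1, 2 all stay
  below 5/2, and the slices [0, 1/2], [2/5, 9/10], [4/5, 13/10] cover the circle.\<close>

lemma half_covers_2_5:
  assumes "q \<ge> 1"
  shows "half_covers (izon [(1, 0), (2, 5), (p, q)])"
proof (rule half_coversI_frac)
  fix X Y :: real assume Y: "0 \<le> Y" "Y < 1"
  have q: "real_of_int q \<ge> 1" using assms by linarith
  obtain t where t: "0 \<le> t" "t \<le> 1 / 2" "0 \<le> Y - t * of_int q" "Y - t * of_int q \<le> 1 / 2"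
  proof (cases "Y \<le> 1 / 2")
    case True
    then show ?thesis using Y by (intro that[of 0]) auto
  next
    case False
    \<comment> \<open>This coefficient lowers the height by exactly 1/2.\<close>
    then show ?thesis using Y q by (intro that[of "1 / (2 * of_int q)"]) (auto simp: field_simps)
  qed
  define y where "y = Y - t * of_int q"
  define z where "z = frac (X - t * of_int p - 2 * y / 5)"
  have z: "0 \<le> z" "z < 1" by (simp_all add: z_def frac_lt_1)
  obtain j :: int where j: "0 \<le> j" "j \<le> 2" "2 * of_int j / 5 \<le> z" "z \<le> 1 / 2 + 2 * of_int j / 5"
  proof -
    consider "z \<le> 1 / 2" | "1 / 2 < z" "z \<le> 9 / 10" | "9 / 10 < z" by linarith
    then show ?thesis
      using z by cases (auto intro: that[of 0] that[of 1] that[of 2])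
  qed
  have y: "0 \<le> y + of_int j" "y + of_int j \<le> 5 / 2" using j t by (auto simp: y_def)
  show "reaches [(1, 0), (2, 5), (p, q)] X Y"
  proof (rule reaches_3[of "z - 2 * of_int j / 5" "(y + of_int j) / 5" t])
    show "X - ((z - 2 * of_int j / 5) * of_int 1 + (y + of_int j) / 5 * of_int 2 + t * of_int p) \<in> \<int>"
      by (simp add: z_def frac_def algebra_simps add_divide_distrib)
    show "Y - ((z - 2 * of_int j / 5) * of_int 0 + (y + of_int j) / 5 * of_int 5 + t * of_int q) \<in> \<int>"
      by (simp add: y_def field_simps)
  qed (use j t y in auto)
qed

text \<open>The vertical slices of half of \<open>P_par 1 k\<close> at abscissae in \<open>[1/k, 1 - 1/k]\<close> have length at
  least one; the third generator moves every point into this range.\<close>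

lemma half_covers_1_k:
  assumes "k \<ge> 2" "p \<ge> 1" "k * p \<ge> 4"
  shows "half_covers (izon [(1, 0), (1, k), (p, q)])"
proof (rule half_coversI_frac)
  fix X Y :: real assume X: "0 \<le> X" "X < 1"
  have k: "real_of_int k \<ge> 2" and p: "real_of_int p \<ge> 1" using assms by linarith+
  have "real_of_int (k * p) \<ge> of_int 4" using assms(3) by (subst of_int_le_iff)
  then have kp: "4 / of_int k \<le> real_of_int p" using k by (simp add: field_simps)
  define e :: real where "e = 1 / of_int k"
  have e: "0 < e" "e \<le> 1 / 2" "e * of_int k = 1" "4 * e \<le> of_int p" using k kp by (auto simp: e_def)
  obtain s and m :: int where s: "0 \<le> s" "s \<le> 1 / 2" "e \<le> X + of_int m - s * of_int p"
    "X + of_int m - s * of_int p \<le> 1 - e"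
  proof -
    consider "e \<le> X" "X \<le> 1 - e" | "X < e" | "1 - e < X" by linarith
    then show ?thesis
    proof cases
      case 1
      then show ?thesis by (intro that[of 0 0]) auto
    next
      case 2
      \<comment> \<open>The point X + 1 is moved back by X + e to the right end 1 - e of the good
        range. As X + e < 2e <= p/2, the coefficient is at most 1/2; this is where the product bound
        4 originates.\<close>
      then show ?thesis using X e p by (intro that[of "(X + e) / of_int p" 1]) (auto simp: field_simps)
    next
      case 3
      then show ?thesis using X e p by (intro that[of "(X - 1 + e) / of_int p" 0]) (auto simp: field_simps)
    qed
  qed
  define x where "x = X + of_int m - s * of_int p"
  \<comment> \<open>The least coefficient of (1, k) possible at abscissa \<open>x\<close>, given
    that (1, 0) supplies the rest within [0, 1/2]. From \<open>lo\<close> to lo + 1/k the height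
    grows by exactly 1, so \<open>r\<close> can be any fractional part.\<close>
  define lo where "lo = max 0 (x - 1 / 2)"
  define r where "r = frac (Y - s * of_int q - of_int k * lo)"
  have r: "0 \<le> r" "r < 1" by (simp_all add: r_def frac_lt_1)
  have "e * r \<le> e" using e r by (simp add: mult_left_le)
  define b where "b = lo + e * r"
  have "0 \<le> lo" "x - 1 / 2 \<le> lo" "lo + e \<le> 1 / 2" "lo + e \<le> x"
    using s(3,4) e unfolding lo_def x_def[symmetric] by (simp_all add: max_def)
  moreover have "0 \<le> e * r" using r e by simp
  ultimately have b: "0 \<le> b" "b \<le> 1 / 2" "b \<le> x" "x - 1 / 2 \<le> b"
    using \<open>e * r \<le> e\<close> unfolding b_def by linarith+
  have "of_int k * b = of_int k * lo + r" using e(3) by (simp add: b_def algebra_simps)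
  then have Y: "Y - (b * of_int k + s * of_int q) = of_int \<lfloor>Y - s * of_int q - of_int k * lo\<rfloor>"
    by (simp add: r_def frac_def algebra_simps)
  show "reaches [(1, 0), (1, k), (p, q)] X Y"
  proof (rule reaches_3[of "x - b" b s])
    show "X - ((x - b) * of_int 1 + b * of_int 1 + s * of_int p) \<in> \<int>" by (simp add: x_def)
    show "Y - ((x - b) * of_int 0 + b * of_int k + s * of_int q) \<in> \<int>" using Y by simp
  qed (use b s in auto)
qed

text \<open>The borderline k = 3, p = 1, where the product 3 misses the bound of
  \<open>half_covers_1_k\<close>. Slices have unit length at abscissae in [1/3, 2/3], and half of
  (1, 1) moves every abscissa there except those strictly between 1/6 and 1/3. These are treated by
  explicit coefficients on either side of the line Y = 3X.\<close>

lemma half_covers_0_1_3: "half_covers (izon [(1, 0), (1, 1), (1, 3)])"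
proof (rule half_coversI_frac)
  fix X Y :: real assume XY: "0 \<le> X" "X < 1" "0 \<le> Y" "Y < 1"
  consider "1 / 3 \<le> X" "X \<le> 1" | "X \<le> 1 / 6" | "1 / 6 < X" "X < 1 / 3" using XY by linarith
  then show "reaches [(1, 0), (1, 1), (1, 3)] X Y"
  proof cases
    case 3
    show ?thesis
    proof (cases "Y \<le> 3 * X")
      case True
      then show ?thesis
        using 3 XY by (intro reaches_3[of "X - Y / 3" 0 "Y / 3"]) auto
    next
      case False
      show ?thesis
      \<comment> \<open>Above the line the representative (X + 1, Y + 1) is reached, using all of
        half of (1, 1).\<close>
      proof (rule reaches_3[of "X + 1 / 3 - Y / 3" "1 / 2" "Y / 3 + 1 / 6"])
        have "X - (X + 1 / 3 - Y / 3 + 1 / 2 + (Y / 3 + 1 / 6)) = - 1"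
          "Y - (1 / 2 + (Y / 3 + 1 / 6) * 3) = - 1" by simp_all
        then show "X - ((X + 1 / 3 - Y / 3) * of_int 1 + 1 / 2 * of_int 1 + (Y / 3 + 1 / 6) * of_int 1) \<in> \<int>"
          "Y - ((X + 1 / 3 - Y / 3) * of_int 0 + 1 / 2 * of_int 1 + (Y / 3 + 1 / 6) * of_int 3) \<in> \<int>"
          by simp_all
      qed (use False 3 XY in linarith)+
    qed
  next
    case 1
    then obtain s where s: "0 \<le> s" "s \<le> 1 / 2" "1 / 3 \<le> X - s" "X - s \<le> 2 / 3"
      using that[of 0] that[of "X - 1 / 2"] by fastforce
    define lo where "lo = max 0 (X - s - 1 / 2)"
    have lo: "0 \<le> lo" "X - s - 1 / 2 \<le> lo" "lo + 1 / 3 \<le> 1 / 2" "lo + 1 / 3 \<le> X - s"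
      using s(3,4) unfolding lo_def by (simp_all add: max_def)
    define r where "r = frac (Y - s - 3 * lo)"
    have r: "0 \<le> r" "r < 1" by (simp_all add: r_def frac_lt_1)
    have "Y - s - 3 * lo - r = of_int \<lfloor>Y - s - 3 * lo\<rfloor>" by (simp add: r_def frac_def)
    then have "Y - (s + (lo + r / 3) * 3) = of_int \<lfloor>Y - s - 3 * lo\<rfloor>" by simp
    then show ?thesis
      using s r lo by (intro reaches_3[of "X - s - (lo + r / 3)" s "lo + r / 3"]) auto
  next
    case 2
    define lo where "lo = X"
    define r where "r = frac (Y - 1 / 2 - 3 * lo)"
    have r: "0 \<le> r" "r < 1" by (simp_all add: r_def frac_lt_1)
    have "Y - 1 / 2 - 3 * lo - r = of_int \<lfloor>Y - 1 / 2 - 3 * lo\<rfloor>" by (simp add: r_def frac_def)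
    then have "Y - (1 / 2 + (lo + r / 3) * 3) = of_int \<lfloor>Y - 1 / 2 - 3 * lo\<rfloor>" by simp
    then show ?thesis
      using 2 XY r
      by (intro reaches_3[of "X + 1 / 2 - (lo + r / 3)" "1 / 2" "lo + r / 3"]) (auto simp: lo_def)
  qed
qed

text \<open>The generator (1, 1) moves the abscissa into [1/4, 3/4]. There the coefficient of (1, 2)
  has a range of length 1/4, hence height 1/2, and half of (0, 1) supplies the other 1/2.\<close>

lemma half_covers_0_1_2_vertical: "half_covers (izon [(1, 0), (1, 2), (0, 1), (1, 1)])"
proof (rule half_coversI_frac)
  fix X Y :: real assume X: "0 \<le> X" "X < 1"
  obtain s and m :: int where s: "0 \<le> s" "s \<le> 1 / 2" "1 / 4 \<le> X + of_int m - s" "X + of_int m - s \<le> 3 / 4"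
  proof -
    consider "1 / 4 \<le> X" "X \<le> 3 / 4" | "X < 1 / 4" | "3 / 4 < X" by linarith
    then show ?thesis
      using X by cases (auto intro: that[of 0 0] that[of "1 / 2" 1] that[of "1 / 2" 0])
  qed
  define x where "x = X + of_int m - s"
  define lo where "lo = max 0 (x - 1 / 2)"
  define r where "r = frac (Y - s - 2 * lo)"
  have r: "0 \<le> r" "r < 1" by (simp_all add: r_def frac_lt_1)
  have lo: "0 \<le> lo" "x - 1 / 2 \<le> lo" "lo + 1 / 4 \<le> 1 / 2" "lo + 1 / 4 \<le> x"
    using s(3,4) unfolding lo_def x_def[symmetric] by (simp_all add: max_def)
  have r_int: "Y - s - 2 * lo - r \<in> \<int>" by (simp add: r_def frac_def)
  show "reaches [(1, 0), (1, 2), (0, 1), (1, 1)] X Y"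
  \<comment> \<open>The missing height \<open>r\<close> is split evenly: r/4 more of (1, 2) and r/2
    of (0, 1) raise the point by r/2 each.\<close>
  proof (rule reaches_4[of "x - (lo + r / 4)" "lo + r / 4" "r / 2" s])
    show "X - ((x - (lo + r / 4)) * of_int 1 + (lo + r / 4) * of_int 1 + r / 2 * of_int 0 + s * of_int 1) \<in> \<int>"
      by (simp add: x_def)
    show "Y - ((x - (lo + r / 4)) * of_int 0 + (lo + r / 4) * of_int 2 + r / 2 * of_int 1 + s * of_int 1) \<in> \<int>"
      using r_int by (simp add: algebra_simps)
  qed (use s r lo in auto)
qed

section \<open>Reduction of the generators\<close>

text \<open>A shear moves the lowest generator to (1, 0). A spread of at least 4 meets the product
  bound with p = 1. For spread 3 the middle height is 1 or 2, and reflection from the top exchanges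
  the two.\<close>

lemma half_covers_heights:
  assumes "y1 < y2" "y2 < y3" "y1 + 3 \<le> y3"
  shows "half_covers (izon [(1, y1), (1, y2), (1, y3)])"
proof -
  consider "y1 + 4 \<le> y3" | "y2 = y1 + 1" "y3 = y1 + 3" | "y2 = y3 - 1" "y1 = y3 - 3"
    using assms by linarith
  then show ?thesis
  proof cases
    case 1
    have "half_covers (izon [(1, y1), (1, y3), (1, y2)])"
    proof (rule half_covers_coord)
      show "half_covers (izon [(1, 0), (1, y3 - y1), (1, y2 - y1)])"
        using half_covers_1_k[of "y3 - y1" 1] 1 by simp
      show "same_up_to_sign (map (coord (1, y1) (0, 1)) [(1, y1), (1, y3), (1, y2)])
          [(1, 0), (1, y3 - y1), (1, y2 - y1)]"
        by (simp add: coord_def idet_def)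
    qed (simp add: idet_def)
    then show ?thesis by (rule half_covers_izon_mono) (simp add: add_mset_commute)
  next
    case 2
    show ?thesis
    proof (rule half_covers_coord)
      show "half_covers (izon [(1, 0), (1, 1), (1, 3)])" by (rule half_covers_0_1_3)
      show "same_up_to_sign (map (coord (1, y1) (0, 1)) [(1, y1), (1, y2), (1, y3)]) [(1, 0), (1, 1), (1, 3)]"
        using 2 by (simp add: coord_def idet_def)
    qed (simp add: idet_def)
  next
    case 3
    have "half_covers (izon [(1, y3), (1, y2), (1, y1)])"
    proof (rule half_covers_coord)
      show "half_covers (izon [(1, 0), (1, 1), (1, 3)])" by (rule half_covers_0_1_3)
      show "same_up_to_sign (map (coord (1, y3) (0, - 1)) [(1, y3), (1, y2), (1, y1)]) [(1, 0), (1, 1), (1, 3)]"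
        using 3 by (simp add: coord_def idet_def)
    qed (simp add: idet_def)
    then show ?thesis by (rule half_covers_izon_mono) (simp add: add_mset_commute)
  qed
qed

section \<open>Coordinates of primitive and parallel vectors\<close>

lemma idet_diff [simp]: "idet (x - y) z = idet x z - idet y z" "idet z (x - y) = idet z x - idet z y"
  by (auto simp: idet_def algebra_simps)

lemma iscale_Pair: "iscale c (a, b) = (c * a, c * b)"
  by (simp add: iscale_def)

lemma coord_linear:
  "coord b1 b2 (x + y) = coord b1 b2 x + coord b1 b2 y"
  "coord b1 b2 (x - y) = coord b1 b2 x - coord b1 b2 y"
  "coord b1 b2 (- x) = - coord b1 b2 x"
  "coord b1 b2 (iscale c x) = iscale c (coord b1 b2 x)"
  by (simp_all add: coord_def iscale_Pair algebra_simps)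

lemma iscale_simps: "iscale 1 x = x" "iscale 0 x = 0" "iscale (- c) x = - iscale c x"
    "iscale a (iscale b x) = iscale (a * b) x"
  by (auto simp: iscale_def prod_eq_iff)

lemma coord_basis:
  assumes "\<bar>idet b1 b2\<bar> = 1"
  shows "coord b1 b2 b1 = (1, 0)" "coord b1 b2 b2 = (0, 1)"
  using assms by (auto simp: coord_def abs_eq_iff')

lemma parallel_primitive:
  assumes "primitive v" "idet v x = 0"
  obtains a where "x = iscale a v"
proof -
  obtain e where e: "idet v e = 1" using primitive_basis[OF assms(1)] ..
  then have "x = iscale (fst (coord v e x)) v"
    using coord_inverse[of v e x] assms(2) by (simp add: coord_def iscale_simps)
  then show ?thesis by (rule that)
qed

lemma primitive_iscale:
  assumes "primitive (iscale a v)"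
  shows "\<bar>a\<bar> = 1"
proof -
  have "is_unit a"
    using assms unfolding primitive_def iscale_def by (auto intro: coprime_common_divisor)
  then show ?thesis by simp
qed

lemma parallel_primitives:
  assumes "primitive v" "primitive w" "idet v w = 0"
  shows "w = v \<or> w = - v"
proof -
  obtain a where "w = iscale a v" using parallel_primitive assms by blast
  moreover from this have "a = 1 \<or> a = - 1" using primitive_iscale assms(2) by fastforce
  ultimately show ?thesis by (auto simp: iscale_simps)
qed

text \<open>Completing \<open>u\<close> to a basis leaves the freedom to add multiples of
  \<open>u\<close> to the second vector, which changes the first coordinate of \<open>w\<close>
  modulo \<open>q\<close>. The remainder of least absolute value satisfies 2|r| <= q; a negative one
  is repaired by changing the signs of \<open>w\<close> and of the second basis vector.\<close>

lemma reduced_form: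
  assumes "primitive u" "idet u w \<noteq> 0"
  obtains p q e where "0 \<le> p" "2 * p \<le> q" "q \<ge> 1" "\<bar>idet u e\<bar> = 1"
    "w = iscale p u + iscale q e \<or> w = - (iscale p u + iscale q e)"
proof -
  obtain e where e: "idet u e = 1" using primitive_basis[OF assms(1)] ..
  define p where "p = fst (coord u e w)"
  define d where "d = idet u w"
  have w: "w = iscale p u + iscale d e"
    using coord_inverse[of u e w] e by (simp add: p_def d_def coord_def)
  define q where "q = \<bar>d\<bar>"
  have "q \<ge> 1" using assms(2) by (simp add: q_def d_def)
  \<comment> \<open>The integer nearest to p/q, as the floor of p/q + 1/2.\<close>
  define j where "j = (2 * p + q) div (2 * q)"
  define r where "r = p - j * q"
  have "2 * p + q = 2 * q * j + (2 * p + q) mod (2 * q)" by (simp add: j_def)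
  moreover have "0 \<le> (2 * p + q) mod (2 * q)" "(2 * p + q) mod (2 * q) < 2 * q"
    using \<open>q \<ge> 1\<close> by simp_all
  ultimately have r: "2 * \<bar>r\<bar> \<le> q" unfolding r_def by (auto simp: abs_if algebra_simps)
  define f where "f = iscale (sgn d) e + iscale j u"
  have "\<bar>idet u f\<bar> = 1" using e assms(2) by (simp add: f_def d_def abs_sgn_eq)
  have w_f: "w = iscale r u + iscale q f"
    by (auto simp: w f_def r_def q_def iscale_def prod_eq_iff algebra_simps abs_sgn)
  show ?thesis
  proof (cases "r \<ge> 0")
    case True
    then show ?thesis using that[of r q f] r w_f \<open>q \<ge> 1\<close> \<open>\<bar>idet u f\<bar> = 1\<close> by auto
  next
    case False
    have "w = - (iscale (- r) u + iscale q (- f))"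
      by (simp add: w_f iscale_def prod_eq_iff)
    then show ?thesis using that[of "- r" q "- f"] r False \<open>q \<ge> 1\<close> \<open>\<bar>idet u f\<bar> = 1\<close> by auto
  qed
qed

text \<open>Primitivity of \<open>w\<close> makes \<open>p\<close> and \<open>q\<close> coprime in
  the reduced form. So p = 0 forces q = 1, and p >= 2 with q < 6 leaves (2, 4), which is not
  coprime, and (2, 5); all pairs with p >= 2 and q >= 6 cover.\<close>

lemma pair_cases:
  assumes "primitive u" "primitive w" "idet u w \<noteq> 0" "\<not> half_covers (izon [u, w])"
  obtains "\<bar>idet u w\<bar> = 1"
  | k e where "k \<ge> 2" "\<bar>idet u e\<bar> = 1" "w = u + iscale k e \<or> w = - (u + iscale k e)"
  | e where "\<bar>idet u e\<bar> = 1"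
      "w = iscale 2 u + iscale 5 e \<or> w = - (iscale 2 u + iscale 5 e)"
proof -
  obtain p q e where pq: "0 \<le> p" "2 * p \<le> q" "q \<ge> 1" and e: "\<bar>idet u e\<bar> = 1"
    and w: "w = iscale p u + iscale q e \<or> w = - (iscale p u + iscale q e)"
    using reduced_form[OF assms(1,3)] by blast
  have "coprime p q"
  proof (rule coprimeI)
    fix c assume c: "c dvd p" "c dvd q"
    have "c dvd fst w" "c dvd snd w" using w c by (auto simp: iscale_def)
    then show "is_unit c" using assms(2) coprime_common_divisor unfolding primitive_def by blast
  qed
  have "\<bar>idet u w\<bar> = \<bar>q * idet u e\<bar>" using w by auto
  then have det: "\<bar>idet u w\<bar> = q" using e pq(3) by (simp add: abs_mult)
  have not6: "\<not> (2 \<le> p \<and> 6 \<le> q)"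
  proof
    assume "2 \<le> p \<and> 6 \<le> q"
    then have "half_covers (izon [(1, 0), (p, q)])" using pq half_covers_parallelogram by blast
    then have "half_covers (izon [u, w])"
    proof (rule half_covers_coord[OF e, rotated])
      show "same_up_to_sign (map (coord u e) [u, w]) [(1, 0), (p, q)]"
        using w by (elim disjE) (simp_all add: coord_linear coord_basis[OF e] iscale_Pair)
    qed
    then show False using assms(4) by contradiction
  qed
  consider "p = 0" | "p = 1" | "p = 2" "q = 4" | "p = 2" "q = 5" | "2 \<le> p" "6 \<le> q"
    using pq by linarith
  then show ?thesis
  proof cases
    case 1
    then show ?thesis using \<open>coprime p q\<close> pq det that(1) by simp
  next
    case 2
    then show ?thesis using that(2)[of q e] pq w e by (simp add: iscale_simps)
  next
    case 3
    then show ?thesis using \<open>coprime p q\<close> coprime_common_divisor[of "2::int" 4 2] by simp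
  next
    case 4
    then show ?thesis using that(3)[of e] w e by simp
  next
    case 5
    then show ?thesis using not6 by blast
  qed
qed

text \<open>Write x as p u + q e up to sign with p >= 0. Primitivity settles p = 0. Otherwise k p <
  4 forces p = 1 and k <= 3, so all three generators have first coordinate 1, with heights 0, k, q.
  These are distinct and must have spread below 3, hence are 0, 2, 1.\<close>

lemma third_generator_1_k:
  assumes e: "\<bar>idet u e\<bar> = 1" and w: "w = u + iscale k e \<or> w = - (u + iscale k e)" and "k \<ge> 2"
    and "primitive x" "idet u x \<noteq> 0" "idet w x \<noteq> 0" "\<not> half_covers (izon [u, w, x])"
  shows "x = e \<or> x = - e \<or> k = 2 \<and> (x = u + e \<or> x = - (u + e))"
proof -
  obtain p q where p: "p \<ge> 0" and x: "x = iscale p u + iscale q e \<or> x = - (iscale p u + iscale q e)"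
  proof (cases "fst (coord u e x) \<ge> 0")
    case True
    then show ?thesis using that coord_inverse[OF e, of x] by metis
  next
    case False
    then show ?thesis
      using that[of "- fst (coord u e x)" "- snd (coord u e x)"] coord_inverse[OF e, of x]
      by (simp add: iscale_simps add.commute)
  qed
  have not_covers: "\<not> half_covers (izon [(1, 0), (1, k), (p, q)])"
  proof
    assume "half_covers (izon [(1, 0), (1, k), (p, q)])"
    then have "half_covers (izon [u, w, x])"
    proof (rule half_covers_coord[OF e, rotated])
      show "same_up_to_sign (map (coord u e) [u, w, x]) [(1, 0), (1, k), (p, q)]"
        using w x by (elim disjE) (simp_all add: coord_linear coord_basis[OF e] iscale_Pair)
    qed
    then show False using assms(7) by contradiction
  qed
  show ?thesis
  proof (cases "p = 0")
    case True
    then have "x = iscale q e \<or> x = iscale (- q) e" using x by (auto simp: iscale_simps)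
    then have "q = 1 \<or> q = - 1" using primitive_iscale \<open>primitive x\<close> by fastforce
    then show ?thesis using x True by (auto simp: iscale_simps)
  next
    case False
    then have "k * p < 4" using half_covers_1_k[of k p q] not_covers p \<open>k \<ge> 2\<close> by fastforce
    moreover have "2 * p \<le> k * p" using p \<open>k \<ge> 2\<close> by (simp add: mult_right_mono)
    ultimately have "p = 1" using False p by linarith
    then have "k \<le> 3" using \<open>k * p < 4\<close> by simp
    have "q \<noteq> 0" using x assms(5) by (auto simp: iscale_simps)
    have "q \<noteq> k"
    proof
      assume "q = k"
      then have "x = w \<or> x = - w" using x w \<open>p = 1\<close> by (auto simp: iscale_simps)
      then show False using assms(6) by auto
    qed
    have "half_covers (izon [(1, 0), (1, k), (p, q)]) \<longleftrightarrow> half_covers (izon [(1, 0), (1, q), (1, k)])"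
      "half_covers (izon [(1, 0), (1, k), (p, q)]) \<longleftrightarrow> half_covers (izon [(1, q), (1, 0), (1, k)])"
      unfolding \<open>p = 1\<close> by (intro arg_cong[where f = half_covers] izon_mset; simp add: add_mset_commute)+
    then have "\<not> (0 < q \<and> q < k \<and> 3 \<le> k)" "\<not> (q < 0 \<and> q + 3 \<le> k)" "\<not> (k < q \<and> 3 \<le> q)"
      using half_covers_heights[of 0 q k] half_covers_heights[of q 0 k] half_covers_heights[of 0 k q]
        not_covers \<open>p = 1\<close> \<open>k \<ge> 2\<close> by auto
    then have "q = 1" "k = 2" using \<open>q \<noteq> 0\<close> \<open>q \<noteq> k\<close> \<open>k \<ge> 2\<close> \<open>k \<le> 3\<close> by linarith+
    then show ?thesis using x \<open>p = 1\<close> by (auto simp: iscale_simps)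
  qed
qed

lemma third_generator_2_5:
  assumes e: "\<bar>idet u e\<bar> = 1"
    and w: "w = iscale 2 u + iscale 5 e \<or> w = - (iscale 2 u + iscale 5 e)" and "idet u x \<noteq> 0"
  shows "half_covers (izon [u, w, x])"
proof -
  define y where "y = (if snd (coord u e x) \<ge> 0 then coord u e x else - coord u e x)"
  have "snd (coord u e x) \<noteq> 0" using e assms(3) by (auto simp: coord_def)
  then have "snd y \<ge> 1" by (auto simp: y_def)
  then have "half_covers (izon [(1, 0), (2, 5), y])"
    using half_covers_2_5[of "snd y" "fst y"] by simp
  then show ?thesis
  proof (rule half_covers_coord[OF e, rotated])
    show "same_up_to_sign (map (coord u e) [u, w, x]) [(1, 0), (2, 5), y]"
      using w by (elim disjE) (simp_all add: coord_linear coord_basis[OF e] iscale_Pair y_def)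
  qed
qed

lemma fourth_generator:
  assumes e: "\<bar>idet u e\<bar> = 1" and w: "w = u + iscale 2 e \<or> w = - (u + iscale 2 e)"
    and "x = e \<or> x = - e" "y = u + e \<or> y = - (u + e)"
  shows "half_covers (izon [u, w, x, y])"
proof (rule half_covers_coord[OF e _ half_covers_0_1_2_vertical])
  show "same_up_to_sign (map (coord u e) [u, w, x, y]) [(1, 0), (1, 2), (0, 1), (1, 1)]"
    using assms(2-4)
    by (elim disjE) (simp_all add: coord_linear coord_basis[OF e] iscale_Pair)
qed

text \<open>In a basis starting with \<open>v\<close> the height of \<open>x\<close> is
  \<open>idet v x\<close>, so total height at least 2 would give the wrap-around covering.\<close>

lemma long_generator:
  assumes "primitive v" "\<bar>m\<bar> \<ge> 2" "\<not> half_covers (izon (iscale m v # xs))"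
  shows "(\<Sum>x\<leftarrow>xs. \<bar>idet v x\<bar>) \<le> 1"
proof (rule ccontr)
  assume *: "\<not> (\<Sum>x\<leftarrow>xs. \<bar>idet v x\<bar>) \<le> 1"
  obtain e where e: "idet v e = 1" using primitive_basis[OF assms(1)] ..
  have "(\<Sum>y\<leftarrow>map (coord v e) xs. \<bar>snd y\<bar>) = (\<Sum>x\<leftarrow>xs. \<bar>idet v x\<bar>)"
    by (simp add: coord_def e o_def)
  then have covers: "half_covers (izon ((m, 0) # map (coord v e) xs))"
    using * assms(2) by (intro half_covers_long_generator) auto
  have coord: "same_up_to_sign (map (coord v e) (iscale m v # xs)) ((m, 0) # map (coord v e) xs)"
    using coord_basis[of v e] e by (auto simp: coord_linear iscale_Pair intro: list.rel_refl)
  have "\<bar>idet v e\<bar> = 1" using e by simp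
  from half_covers_coord[OF this coord covers] have "half_covers (izon (iscale m v # xs))" .
  then show False using assms(3) by contradiction
qed

text \<open>Nonnegative integers with sum at most 1 contain at most one nonzero entry. The multiset
  form removes a single occurrence of \<open>w\<close>, so a second copy is excluded as
  well.\<close>

lemma sum_list_le_1:
  fixes f :: "'a \<Rightarrow> int"
  assumes "(\<Sum>x\<leftarrow>xs. \<bar>f x\<bar>) \<le> 1" "\<exists>x\<in>set xs. f x \<noteq> 0"
  shows "\<exists>w M. mset xs = add_mset w M \<and> \<bar>f w\<bar> = 1 \<and> (\<forall>x\<in>#M. f x = 0)"
proof -
  obtain w where w: "w \<in> set xs" "f w \<noteq> 0" using assms(2) by blast
  then obtain M where M: "mset xs = add_mset w M" using multi_member_split[of w "mset xs"] by auto
  have nonneg: "(\<Sum>x\<in>#N. \<bar>f x\<bar>) \<ge> 0" for N by (induction N) auto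
  have "(\<Sum>x\<leftarrow>xs. \<bar>f x\<bar>) = (\<Sum>x\<in>#mset xs. \<bar>f x\<bar>)" by (simp add: sum_mset_sum_list flip: mset_map)
  then have *: "\<bar>f w\<bar> + (\<Sum>x\<in>#M. \<bar>f x\<bar>) \<le> 1" using M assms(1) by simp
  then have "\<bar>f w\<bar> = 1" and sum: "(\<Sum>x\<in>#M. \<bar>f x\<bar>) = 0" using w(2) nonneg[of M] by linarith+
  have "f x = 0" if x: "x \<in># M" for x
  proof -
    obtain N where "M = add_mset x N" using multi_member_split[OF x] by blast
    then show ?thesis using sum nonneg[of N] by simp
  qed
  then show ?thesis using M \<open>\<bar>f w\<bar> = 1\<close> by blast
qed

lemma parallel_generators:
  assumes "primitive v" "\<bar>m\<bar> \<ge> 2" "\<not> half_covers (izon (iscale m v # xs))"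
    and "\<exists>x\<in>set xs. idet v x \<noteq> 0"
  obtains w M where "mset xs = add_mset w M" "\<bar>idet v w\<bar> = 1" "\<And>x. x \<in># M \<Longrightarrow> idet v x = 0"
proof -
  have "(\<Sum>x\<leftarrow>xs. \<bar>idet v x\<bar>) \<le> 1" by (rule long_generator[OF assms(1-3)])
  from sum_list_le_1[OF this assms(4)] obtain w M
    where M: "mset xs = add_mset w M" "\<bar>idet v w\<bar> = 1" "\<forall>x\<in>#M. idet v x = 0"
    by (elim exE conjE)
  show ?thesis by (rule that[OF M(1,2)]) (use M(3) in blast)
qed

lemma spanning_primitive:
  assumes "primitive v" "\<exists>x\<in>set xs. \<exists>y\<in>set xs. idet x y \<noteq> 0"
  shows "\<exists>x\<in>set xs. idet v x \<noteq> 0"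
proof (rule ccontr)
  assume *: "\<not> (\<exists>x\<in>set xs. idet v x \<noteq> 0)"
  have "idet x y = 0" if "x \<in> set xs" "y \<in> set xs" for x y
  proof -
    have "idet v x = 0" using * that by blast
    from parallel_primitive[OF assms(1) this] obtain a where "x = iscale a v" .
    then show ?thesis using * that by simp
  qed
  then show False using assms(2) by blast
qed

lemma primitive_part:
  assumes "x \<noteq> 0" "\<not> primitive x"
  obtains g v where "g \<ge> 2" "primitive v" "x = iscale g v"
proof -
  define g where "g = gcd (fst x) (snd x)"
  have "fst x \<noteq> 0 \<or> snd x \<noteq> 0" using assms(1) by (simp add: prod_eq_iff)
  then have "g > 0" by (auto simp: g_def)
  moreover have "g \<noteq> 1" using assms(2) by (simp add: g_def primitive_def coprime_iff_gcd_eq_1)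
  ultimately have "g \<ge> 2" by simp
  moreover have "primitive (fst x div g, snd x div g)"
    using div_gcd_coprime[of "fst x" "snd x"] \<open>fst x \<noteq> 0 \<or> snd x \<noteq> 0\<close>
    by (auto simp: primitive_def g_def)
  moreover have "x = iscale g (fst x div g, snd x div g)"
    by (simp add: iscale_Pair g_def prod_eq_iff)
  ultimately show ?thesis by (rule that)
qed

lemma plucker_relation:
  "idet a b * idet c d - idet a c * idet b d + idet a d * idet b c = 0"
  by (simp add: idet_def algebra_simps)

lemma no_four_unimodular:
  assumes "\<bar>idet a b\<bar> = 1" "\<bar>idet c d\<bar> = 1" "\<bar>idet a c\<bar> = 1" "\<bar>idet b d\<bar> = 1" "\<bar>idet a d\<bar> = 1"
    "\<bar>idet b c\<bar> = 1"
  shows False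
proof -
  have odd: "odd i" if "\<bar>i\<bar> = 1" for i :: int using that by (auto simp: abs_eq_iff')
  have "odd (idet a b * idet c d - idet a c * idet b d + idet a d * idet b c)"
    using assms[THEN odd] by simp
  then show False using plucker_relation[of a b c d] by simp
qed

text \<open>Each alternative keeps the original generators and records just the determinants or
  coordinates that both applications use: the computation of normal forms and the test of linear
  dependences.\<close>

lemma noncovering_cases:
  assumes nonzero: "0 \<notin> set xs" and span: "\<exists>x\<in>set xs. \<exists>y\<in>set xs. idet x y \<noteq> 0"
    and not_covers: "\<not> half_covers (izon xs)"
  obtains (strip) v w M where "mset xs = add_mset w M" "\<bar>idet v w\<bar> = 1" "\<And>x. x \<in># M \<Longrightarrow> idet v x = 0"
  | (width_2) u w e k where "mset xs = {#u, w#}" "\<bar>idet u e\<bar> = 1" "k \<ge> 2"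
      "w = u + iscale k e \<or> w = - (u + iscale k e)"
  | (hexagon) u w x where "mset xs = {#u, w, x#}" "\<bar>idet u x\<bar> = 1" "\<bar>idet w x\<bar> = 1" "idet u w \<noteq> 0"
  | (width_3) u w e where "mset xs = {#u, w#}" "\<bar>idet u e\<bar> = 1"
      "w = iscale 2 u + iscale 5 e \<or> w = - (iscale 2 u + iscale 5 e)"
proof -
  have sub: "\<not> half_covers (izon ys)" if "mset ys \<subseteq># mset xs" for ys
    using half_covers_izon_mono that not_covers by blast
  consider x where "x \<in> set xs" "\<not> primitive x"
    | x y M where "\<And>x. x \<in> set xs \<Longrightarrow> primitive x" "mset xs = add_mset x (add_mset y M)" "idet x y = 0"
    | "\<And>x. x \<in> set xs \<Longrightarrow> primitive x"
      "\<And>x y M. mset xs = add_mset x (add_mset y M) \<Longrightarrow> idet x y \<noteq> 0"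
    by blast
  then show thesis
  proof cases
    case (1 x)
    then have "x \<noteq> 0" using nonzero by auto
    from primitive_part[OF this 1(2)] obtain g v
      where g: "g \<ge> 2" and v: "primitive v" and x: "x = iscale g v" .
    obtain M where M: "mset xs = add_mset x M" using 1 multi_member_split[of x "mset xs"] by auto
    obtain ys where ys: "mset ys = M" using ex_mset by blast
    have "mset (iscale g v # ys) = mset xs" using M ys x by simp
    then have not_covers: "\<not> half_covers (izon (iscale g v # ys))" by (intro sub) simp
    have "set xs = insert x (set ys)" using M ys by (metis set_mset_add_mset_insert set_mset_mset)
    then have "\<exists>y\<in>set ys. idet v y \<noteq> 0"
      using spanning_primitive[OF v span] x by auto
    from parallel_generators[OF v _ not_covers this] g obtain w N
      where N: "mset ys = add_mset w N" "\<bar>idet v w\<bar> = 1" "\<And>x. x \<in># N \<Longrightarrow> idet v x = 0"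
      by auto
    show thesis
    proof (rule strip)
      show "mset xs = add_mset w (add_mset x N)" using M ys N by simp
    qed (use N x in auto)
  next
    case (2 x y M)
    have "x \<in> set xs" "y \<in> set xs" using 2(2) by (metis set_mset_mset insertI1 insertI2 set_mset_add_mset_insert)+
    then have x: "primitive x" and y: "y = x \<or> y = - x"
      using 2(1) parallel_primitives[OF _ _ 2(3)] by auto
    obtain ys where ys: "mset ys = M" using ex_mset by blast
    have "\<not> half_covers (izon (x # y # ys))" using 2(2) ys by (intro sub) simp
    moreover have "same_up_to_sign (x # y # ys) (x # x # ys)" using y by (auto intro: list.rel_refl)
    ultimately have "\<not> half_covers (izon (x # x # ys))"
      using half_covers_unimodular unimodularly_equivalent_sign by blast
    \<comment> \<open>Two parallel primitive generators act as one generator of multiplicity 2,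
      which returns to the non-primitive situation.\<close>
    moreover have "izon (x # x # ys) = izon (iscale 2 x # ys)"
      using zonotope_scaled[of 1 1 "ivec x" "map ivec ys"] by (simp add: ivec_iscale)
    ultimately have not_covers: "\<not> half_covers (izon (iscale 2 x # ys))" by simp
    have "set xs = {x, y} \<union> set ys" using 2(2) ys by (metis Un_insert_left insert_is_Un set_mset_add_mset_insert set_mset_mset sup_bot_left)
    then have "\<exists>z\<in>set ys. idet x z \<noteq> 0"
      using spanning_primitive[OF x span] 2(3) by auto
    from parallel_generators[OF x _ not_covers this] obtain w N
      where N: "mset ys = add_mset w N" "\<bar>idet x w\<bar> = 1" "\<And>z. z \<in># N \<Longrightarrow> idet x z = 0"
      by auto
    show thesis
    proof (rule strip)
      show "mset xs = add_mset w (add_mset x (add_mset y N))" using 2(2) ys N by simp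
    qed (use N 2(3) in auto)
  next
    case 3
    note prim = 3(1) and det = 3(2)
    have prim': "primitive x" if "mset xs = add_mset x M" for x M
      using prim that by (metis set_mset_mset insertI1 set_mset_add_mset_insert)
    have triple: "idet u w \<noteq> 0" "idet u x \<noteq> 0" "idet w x \<noteq> 0" "primitive u" "primitive w" "primitive x"
        "\<not> half_covers (izon [u, w])" "\<not> half_covers (izon [u, w, x])"
      if M: "mset xs = add_mset u (add_mset w (add_mset x M))" for u w x M
    proof -
      have *: "mset xs = add_mset x (add_mset u (add_mset w M))"
        "mset xs = add_mset u (add_mset x (add_mset w M))"
        "mset xs = add_mset w (add_mset x (add_mset u M))"
        using M by (auto simp: add_mset_commute)
      show "idet u w \<noteq> 0" "idet u x \<noteq> 0" "idet w x \<noteq> 0"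
        using det[OF M] det[OF *(2)] det[OF *(3)] by auto
      show "primitive u" "primitive w" "primitive x"
        using prim'[OF M] prim'[OF *(3)] prim'[OF *(1)] by auto
      show "\<not> half_covers (izon [u, w])" "\<not> half_covers (izon [u, w, x])"
        by (rule sub; simp add: M)+
    qed
    obtain a b where ab: "a \<in> set xs" "b \<in> set xs" "idet a b \<noteq> 0" using span by blast
    then have "a \<noteq> b" by auto
    then obtain N where N: "mset xs = add_mset a (add_mset b N)"
      using ab by (metis in_multiset_in_set insert_noteq_member multi_member_split)
    \<comment> \<open>A pair of type \<open>P_par 1 k\<close> with k >= 2 determines the rest: any
      further generator is one of very few vectors, and two further ones would cover.\<close>
    have three: "M = {#} \<and> \<bar>idet u x\<bar> = 1 \<and> \<bar>idet w x\<bar> = 1"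
      if M: "mset xs = add_mset u (add_mset w (add_mset x M))" and e: "\<bar>idet u e\<bar> = 1" and "k \<ge> 2"
      and w: "w = u + iscale k e \<or> w = - (u + iscale k e)" for u w e k x M
    proof -
      have third: "y = e \<or> y = - e \<or> k = 2 \<and> (y = u + e \<or> y = - (u + e))"
        if "mset xs = add_mset u (add_mset w (add_mset y N))" for y N
        by (rule third_generator_1_k[OF e w \<open>k \<ge> 2\<close>]) (use triple[OF that] in auto)
      have "M = {#}"
      proof (rule ccontr)
        assume "M \<noteq> {#}"
        then obtain y N where N: "M = add_mset y N" using multiset_cases by metis
        have "mset xs = add_mset x (add_mset y (add_mset u (add_mset w N)))"
          "mset xs = add_mset u (add_mset w (add_mset y (add_mset x N)))"
          using M N by (auto simp: add_mset_commute)
        then have "idet x y \<noteq> 0" and y: "y = e \<or> y = - e \<or> k = 2 \<and> (y = u + e \<or> y = - (u + e))"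
          using det third by (blast, blast)
        \<comment> \<open>Two vectors of the same kind are parallel, so \<open>x\<close> and
          \<open>y\<close> are of different kinds. One of them is then u + e up to sign, which
          forces k = 2.\<close>
        moreover have "(x = e \<or> x = - e) \<and> (y = e \<or> y = - e) \<Longrightarrow> idet x y = 0"
          "(x = u + e \<or> x = - (u + e)) \<and> (y = u + e \<or> y = - (u + e)) \<Longrightarrow> idet x y = 0"
          using idet_commute[of e u] by auto
        ultimately have "k = 2" and
          "(x = e \<or> x = - e) \<and> (y = u + e \<or> y = - (u + e)) \<or>
           (y = e \<or> y = - e) \<and> (x = u + e \<or> x = - (u + e))"
          using third[OF M] by blast+
        then have "half_covers (izon [u, w, x, y]) \<or> half_covers (izon [u, w, y, x])"
          using fourth_generator[OF e] w by blast
        moreover have "\<not> half_covers (izon [u, w, x, y])" "\<not> half_covers (izon [u, w, y, x])"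
          using M N by (intro sub; simp add: add_mset_commute)+
        ultimately show False by blast
      qed
      moreover have "\<bar>idet u x\<bar> = 1 \<and> \<bar>idet w x\<bar> = 1"
        using third[OF M] w e by (elim disjE conjE) (simp_all add: idet_commute[of e u])
      ultimately show ?thesis by blast
    qed
    show thesis
    proof (cases "N = {#}")
      case True
      have "\<not> half_covers (izon [a, b])" using N by (intro sub) simp
      from pair_cases[OF prim[OF ab(1)] prim[OF ab(2)] ab(3) this] show thesis
      proof cases
        case 1
        \<comment> \<open>A unimodular pair is a strip whose vertical part consists of
          \<open>a\<close> alone.\<close>
        then show ?thesis using N True by (intro strip[of b "{#a#}" a]) (auto simp: add_mset_commute)
      next
        case (2 k e)
        then show ?thesis using N True by (intro width_2[of a b]) auto
      next
        case (3 e)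
        then show ?thesis using N True by (intro width_3[of a b]) auto
      qed
    next
      case False
      show thesis
      \<comment> \<open>Arguing by contradiction lets \<open>unimodular\<close> be proved for every
        pair: a pair with k >= 2 already yields the alternative \<open>hexagon\<close>, and a pair
        of type \<open>P_par 2 5\<close> covers together with any third generator.\<close>
      proof (rule ccontr)
        assume no_thesis: "\<not> thesis"
        have unimodular: "\<bar>idet u w\<bar> = 1" if M: "mset xs = add_mset u (add_mset w (add_mset x M))" for u w x M
        proof -
          note triple = triple[OF M]
          from pair_cases[OF triple(4,5,1,7)] show ?thesis
          proof cases
            case 1
            then show ?thesis .
          next
            case (2 k e)
            then have "mset xs = {#u, w, x#}" "\<bar>idet u x\<bar> = 1" "\<bar>idet w x\<bar> = 1"
              using three[OF M] M by auto
            then have thesis using triple(1) by (rule hexagon)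
            then show ?thesis using no_thesis by contradiction
          next
            case (3 e)
            then show ?thesis using third_generator_2_5 triple by blast
          qed
        qed
        obtain c M where "N = add_mset c M" using False multiset_cases by metis
        then have M: "mset xs = add_mset a (add_mset b (add_mset c M))" using N by simp
        then have c: "mset xs = add_mset a (add_mset c (add_mset b M))"
          "mset xs = add_mset b (add_mset c (add_mset a M))" by (auto simp: add_mset_commute)
        note ab = unimodular[OF M] and ac = unimodular[OF c(1)] and bc = unimodular[OF c(2)]
        show False
        proof (cases "M = {#}")
          case True
          then have thesis using hexagon[of a b c] M ac bc ab by auto
          then show False using no_thesis by contradiction
        next
          case False
          then obtain d L where "M = add_mset d L" using multiset_cases by metis
          then have d: "mset xs = add_mset c (add_mset d (add_mset a (add_mset b L)))"
            "mset xs = add_mset b (add_mset d (add_mset a (add_mset c L)))"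
            "mset xs = add_mset a (add_mset d (add_mset b (add_mset c L)))"
            using M by (auto simp: add_mset_commute)
          from no_four_unimodular[OF ab unimodular[OF d(1)] ac unimodular[OF d(2)] unimodular[OF d(3)] bc]
          show False .
        qed
      qed
    qed
  qed
qed

section \<open>Normal forms, widths and areas\<close>

lemma izon_filter_nonzero: "izon (filter (\<lambda>x. x \<noteq> 0) xs) = izon xs"
  by (induction xs) (simp_all add: zonotope_Cons ivec_0 flip: set_zero)

lemma unimodularly_equivalent_basis:
  assumes "mset xs = mset ys" "\<bar>idet b1 b2\<bar> = 1" "same_up_to_sign (map (coord b1 b2) ys) zs"
  shows "unimodularly_equivalent (izon xs) (izon zs)"
  unfolding izon_mset[OF assms(1)]
  using unimodularly_equivalent_coord[OF assms(2)] unimodularly_equivalent_sign[OF assms(3)]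
  by (rule unimodularly_equivalent_trans)

lemma izon_vertical:
  assumes "\<forall>c\<in>set cs. 0 \<le> c"
  shows "izon (map (Pair 0) cs) = izon [(0, sum_list cs)]"
  using assms
proof (induction cs)
  case Nil
  have "ivec (0, 0) = 0" using ivec_0 by (simp add: zero_prod_def)
  then show ?case by (simp add: zonotope_Cons set_plus_def)
next
  case (Cons c cs)
  have ivec: "ivec (0, d) = of_int d *\<^sub>R ivec (0, 1)" for d
    using ivec_iscale[of d "(0, 1)"] by (simp add: iscale_Pair)
  have "izon (map (Pair 0) (c # cs)) = closed_segment 0 (ivec (0, c)) + izon [(0, sum_list cs)]"
    using Cons by (simp add: zonotope_Cons)
  also have "\<dots> = zonotope [of_int c *\<^sub>R ivec (0, 1), of_int (sum_list cs) *\<^sub>R ivec (0, 1)]"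
    using ivec[of c] ivec[of "sum_list cs"] by (simp add: zonotope_Cons)
  also have "\<dots> = zonotope [(of_int c + of_int (sum_list cs)) *\<^sub>R ivec (0, 1)]"
  proof (rule zonotope_scaled)
    show "0 \<le> real_of_int (sum_list cs)" using Cons.prems by (simp add: sum_list_nonneg)
  qed (use Cons.prems in simp)
  also have "\<dots> = izon [(0, sum_list (c # cs))]"
    using ivec[of "c + sum_list cs"] by simp
  finally show ?case .
qed

text \<open>In the basis \<open>w\<close>, \<open>v\<close> the generator \<open>w\<close> becomes
  (1, 0) and all others are vertical. After sign changes they add up to a single vertical segment,
  and \<open>k\<close> is the sum of their lengths.\<close>

lemma strip_equivalent:
  assumes xs: "mset xs = add_mset w M" and det: "\<bar>idet v w\<bar> = 1" "\<And>x. x \<in># M \<Longrightarrow> idet v x = 0"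
    and "M \<noteq> {#}" "0 \<notin># M"
  obtains k where "k \<ge> 1" "unimodularly_equivalent (izon xs) (izon [(1, 0), (0, k)])"
proof -
  obtain ys where ys: "mset ys = M" using ex_mset by blast
  define f where "f x = snd (coord w v x)" for x
  have wv: "\<bar>idet w v\<bar> = 1" using det(1) by (simp add: idet_commute[of w v])
  have coord: "coord w v x = (0, f x)" if "x \<in> set ys" for x
    using det(2)[of x] that ys by (auto simp: coord_def f_def idet_commute[of x v])
  have f: "\<bar>f x\<bar> \<ge> 1" if "x \<in> set ys" for x
  proof -
    have "x \<noteq> 0" using that assms(5) ys by auto
    then have "f x \<noteq> 0" using coord_inverse[OF wv, of x] coord[OF that] by (auto simp: iscale_simps)
    then show ?thesis by simp
  qed
  define cs where "cs = map (\<lambda>x. \<bar>f x\<bar>) ys"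
  have "same_up_to_sign (map (coord w v) ys) (map (Pair 0) cs)"
    by (auto simp: cs_def list_all2_map1 list_all2_map2 list_all2_same coord abs_if)
  then have "same_up_to_sign (map (coord w v) (w # ys)) ((1, 0) # map (Pair 0) cs)"
    by (simp add: coord_basis[OF wv])
  moreover have "mset xs = mset (w # ys)" using xs ys by simp
  ultimately have "unimodularly_equivalent (izon xs) (izon ((1, 0) # map (Pair 0) cs))"
    using unimodularly_equivalent_basis[OF _ wv] by blast
  also have "izon ((1, 0) # map (Pair 0) cs) = izon [(1, 0), (0, sum_list cs)]"
    using izon_vertical[of cs] by (simp add: cs_def zonotope_Cons)
  finally have equiv: "unimodularly_equivalent (izon xs) (izon [(1, 0), (0, sum_list cs)])" .
  obtain y zs where "ys = y # zs" using ys assms(4) by (cases ys) auto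
  moreover have "0 \<le> (\<Sum>x\<leftarrow>zs. \<bar>f x\<bar>)" by (rule sum_list_nonneg) auto
  ultimately have "sum_list cs \<ge> 1" using f[of y] by (simp add: cs_def)
  then show ?thesis using equiv by (rule that)
qed

lemma parallelogram_equivalent:
  assumes "mset xs = {#u, w#}" and e: "\<bar>idet u e\<bar> = 1"
    and w: "w = iscale p u + iscale q e \<or> w = - (iscale p u + iscale q e)"
  shows "unimodularly_equivalent (izon xs) (izon [(1, 0), (p, q)])"
proof (rule unimodularly_equivalent_basis[OF _ e])
  show "mset xs = mset [u, w]" using assms by simp
  show "same_up_to_sign (map (coord u e) [u, w]) [(1, 0), (p, q)]"
    using w by (elim disjE) (simp_all add: coord_linear coord_basis[OF e] iscale_Pair)
qed

lemma hexagon_equivalent: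
  assumes xs: "mset xs = {#u, w, x#}" and det: "\<bar>idet u x\<bar> = 1" "\<bar>idet w x\<bar> = 1" "idet u w \<noteq> 0"
  shows "unimodularly_equivalent (izon xs) (izon [(0, 1), (1, 0), (1, \<bar>idet u w\<bar>)])"
proof -
  \<comment> \<open>The sign is chosen so that both coordinates of \<open>w\<close> in the basis
    \<open>u\<close>, \<open>y\<close> have the same sign, hence \<open>w\<close> is (1, k) up to
    sign.\<close>
  define y where "y = (if idet w x * idet u w > 0 then x else - x)"
  have y: "y = x \<or> y = - x" by (simp add: y_def)
  have uy: "\<bar>idet u y\<bar> = 1" "\<bar>idet w y\<bar> = 1" using det y by auto
  have "idet w x * idet u w \<noteq> 0" using det by auto
  moreover have "idet w y * idet u w = \<bar>idet w x * idet u w\<bar>" by (simp add: y_def abs_if)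
  ultimately have pos: "idet w y * idet u w > 0" by (simp only: zero_less_abs_iff not_False_eq_True)
  have w: "coord u y w = (1, \<bar>idet u w\<bar>) \<or> coord u y w = - (1, \<bar>idet u w\<bar>)"
    using uy pos by (auto simp: coord_def abs_if zero_less_mult_iff split: if_splits)
  show ?thesis
  proof (rule unimodularly_equivalent_basis[OF _ uy(1)])
    show "mset xs = mset [x, u, w]" using xs by (simp add: add_mset_commute)
    have "x = y \<or> x = - y" using y by auto
    then have "coord u y x = (0, 1) \<or> coord u y x = - (0, 1)"
      using coord_basis(2)[OF uy(1)] by (auto simp: coord_linear)
    then show "same_up_to_sign (map (coord u y) [x, u, w]) [(0, 1), (1, 0), (1, \<bar>idet u w\<bar>)]"
      using w by (simp add: coord_basis[OF uy(1)])
  qed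
qed

section \<open>Lattice widths of zonotopes\<close>

lemma interval_set_plus:
  fixes a b c d :: real
  assumes "a \<le> b" "c \<le> d"
  shows "{a..b} + {c..d} = {a + c..b + d}"
proof
  show "{a + c..b + d} \<subseteq> {a..b} + {c..d}"
  proof
    fix x assume "x \<in> {a + c..b + d}"
    then have "max a (x - d) + (x - max a (x - d)) \<in> {a..b} + {c..d}"
      using assms by (intro set_plus_intro) (auto simp: max_def)
    then show "x \<in> {a..b} + {c..d}" by simp
  qed
qed (auto elim!: set_plus_elim)

text \<open>A functional maps a Minkowski sum of segments to a sum of intervals, so its extreme
  values are read off generator by generator.\<close>

lemma inner_image_zonotope:
  "(\<lambda>x. z \<bullet> x) ` zonotope us = {\<Sum>u\<leftarrow>us. min 0 (z \<bullet> u)..\<Sum>u\<leftarrow>us. max 0 (z \<bullet> u)}"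
proof (induction us)
  case (Cons u us)
  have "(\<lambda>x. z \<bullet> x) ` closed_segment 0 u = closed_segment 0 (z \<bullet> u)"
    using closed_segment_linear_image[of "\<lambda>x. z \<bullet> x" 0 u] by (simp add: bounded_linear.linear bounded_linear_inner_right)
  also have "\<dots> = {min 0 (z \<bullet> u)..max 0 (z \<bullet> u)}"
    by (simp add: closed_segment_eq_real_ivl min_def max_def)
  finally have segment: "(\<lambda>x. z \<bullet> x) ` closed_segment 0 u = {min 0 (z \<bullet> u)..max 0 (z \<bullet> u)}" .
  have "(\<lambda>x. z \<bullet> x) ` (A + B) = (\<lambda>x. z \<bullet> x) ` A + (\<lambda>x. z \<bullet> x) ` B" for A B
    by (force simp: set_plus_def image_iff inner_add_right)
  moreover have "(\<Sum>u\<leftarrow>us. min 0 (z \<bullet> u)) \<le> (\<Sum>u\<leftarrow>us. max 0 (z \<bullet> u))"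
    by (rule sum_list_mono) auto
  ultimately show ?case
    using Cons segment by (simp add: zonotope_Cons interval_set_plus)
qed simp

lemma directional_width_zonotope:
  "(SUP x\<in>zonotope us. z \<bullet> x) - (INF x\<in>zonotope us. z \<bullet> x) = (\<Sum>u\<leftarrow>us. \<bar>z \<bullet> u\<bar>)"
proof -
  have "(\<Sum>u\<leftarrow>us. min 0 (z \<bullet> u)) \<le> (\<Sum>u\<leftarrow>us. max 0 (z \<bullet> u))"
    by (rule sum_list_mono) auto
  then have "(SUP x\<in>zonotope us. z \<bullet> x) - (INF x\<in>zonotope us. z \<bullet> x) =
      (\<Sum>u\<leftarrow>us. max 0 (z \<bullet> u)) - (\<Sum>u\<leftarrow>us. min 0 (z \<bullet> u))"
    by (simp add: inner_image_zonotope)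
  also have "\<dots> = (\<Sum>u\<leftarrow>us. \<bar>z \<bullet> u\<bar>)" by (induction us) auto
  finally show ?thesis .
qed

lemma inner_ivec: "ivec x \<bullet> ivec y = of_int (fst x * fst y + snd x * snd y)"
  by (simp add: inner_vec_def sum_2)

text \<open>Reduces a width to a certificate over the integers: one direction \<open>c\<close>
  attaining \<open>n\<close> and a lower bound valid for all nonzero integral directions (a,
  b).\<close>

lemma lattice_width_izon:
  assumes "c \<noteq> 0" "(\<Sum>x\<leftarrow>xs. \<bar>fst c * fst x + snd c * snd x\<bar>) = n"
    and "\<And>a b. a \<noteq> 0 \<or> b \<noteq> 0 \<Longrightarrow> n \<le> (\<Sum>x\<leftarrow>xs. \<bar>a * fst x + b * snd x\<bar>)"
  shows "lattice_width (izon xs) = of_int n"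
proof -
  have width: "(SUP x\<in>izon xs. ivec c \<bullet> x) - (INF x\<in>izon xs. ivec c \<bullet> x) =
      of_int (\<Sum>x\<leftarrow>xs. \<bar>fst c * fst x + snd c * snd x\<bar>)" for c
    unfolding directional_width_zonotope by (induction xs) (simp_all add: inner_ivec)
  have ivec_nonzero: "ivec c \<noteq> 0 \<longleftrightarrow> c \<noteq> 0" for c using ivec_eq_iff[of c 0] by (simp add: ivec_0)
  show ?thesis
    unfolding lattice_width_def
  proof (rule cInf_eq_minimum)
    show "of_int n \<in> (\<lambda>z. (SUP x\<in>izon xs. z \<bullet> x) - (INF x\<in>izon xs. z \<bullet> x)) ` (int_lattice - {0})"
      using assms(1,2) width[of c] by (intro image_eqI[of _ _ "ivec c"]) (auto simp: int_lattice_2 ivec_nonzero)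
    fix y assume "y \<in> (\<lambda>z. (SUP x\<in>izon xs. z \<bullet> x) - (INF x\<in>izon xs. z \<bullet> x)) ` (int_lattice - {0})"
    then obtain z where "z \<in> range ivec" "z \<noteq> 0"
      "y = (SUP x\<in>izon xs. z \<bullet> x) - (INF x\<in>izon xs. z \<bullet> x)"
      by (auto simp only: int_lattice_2)
    then obtain c where c: "c \<noteq> 0" "y = (SUP x\<in>izon xs. ivec c \<bullet> x) - (INF x\<in>izon xs. ivec c \<bullet> x)"
      using ivec_nonzero by blast
    then show "of_int n \<le> y"
      using assms(3)[of "fst c" "snd c"] unfolding c(2) width of_int_le_iff by (auto simp: prod_eq_iff)
  qed
qed

lemma lattice_width_strip:
  assumes "k \<ge> 1"
  shows "lattice_width (izon [(1, 0), (0, k)]) = 1"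
proof -
  have "1 \<le> \<bar>a\<bar> + \<bar>b * k\<bar>" if "a \<noteq> 0 \<or> b \<noteq> 0" for a b
  proof -
    have "1 \<le> \<bar>b * k\<bar>" if "b \<noteq> 0" using assms that by (simp add: int_one_le_iff_zero_less)
    then show ?thesis using that by (cases "b = 0") auto
  qed
  then show ?thesis using lattice_width_izon[of "(1, 0)" "[(1, 0), (0, k)]" 1] by (simp add: zero_prod_def)
qed

lemma abs_mult_ge:
  fixes b k :: int
  assumes "b \<noteq> 0" "k \<ge> 0"
  shows "\<bar>b * k\<bar> \<ge> k"
proof -
  have "1 * k \<le> \<bar>b\<bar> * k" using assms by (intro mult_right_mono) auto
  then show ?thesis using assms by (simp add: abs_mult)
qed

text \<open>For b nonzero the triangle inequality bounds the width below by |b k| >= k; for b = 0 it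
  is 2|a|.\<close>

lemma lattice_width_P_1:
  assumes "k \<ge> 2"
  shows "lattice_width (izon [(1, 0), (1, k)]) = 2"
proof -
  have "2 \<le> \<bar>a\<bar> + \<bar>a + b * k\<bar>" if "a \<noteq> 0 \<or> b \<noteq> 0" for a b
    using that assms abs_mult_ge[of b k] by (cases "b = 0") auto
  then show ?thesis using lattice_width_izon[of "(1, 0)" "[(1, 0), (1, k)]" 2] by (simp add: zero_prod_def)
qed

lemma lattice_width_hexagon:
  assumes "k \<ge> 1"
  shows "lattice_width (izon [(0, 1), (1, 0), (1, k)]) = 2"
proof -
  have "2 \<le> \<bar>b\<bar> + (\<bar>a\<bar> + \<bar>a + b * k\<bar>)" if "a \<noteq> 0 \<or> b \<noteq> 0" for a b
    using that assms abs_mult_ge[of b k] by (cases "b = 0") auto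
  then show ?thesis using lattice_width_izon[of "(1, 0)" "[(0, 1), (1, 0), (1, k)]" 2] by (simp add: zero_prod_def)
qed

lemma lattice_width_P_2_5: "lattice_width (izon [(1, 0), (2, 5)]) = 3"
proof -
  have "3 \<le> \<bar>a\<bar> + \<bar>a * 2 + b * 5\<bar>" if "a \<noteq> 0 \<or> b \<noteq> 0" for a b :: int
    using that by presburger
  then show ?thesis using lattice_width_izon[of "(1, 0)" "[(1, 0), (2, 5)]" 3] by (simp add: zero_prod_def)
qed

text \<open>Convex hulls commute with Minkowski sums, so the zonotope is the hull of the eight
  subset sums of its generators.\<close>

lemma izon_hexagon:
  "izon [(0, 1), (1, 0), (1, k)] =
    convex hull (ivec ` {(0, 0), (0, 1), (1, 0), (1, 1), (1, k), (1, k + 1), (2, k), (2, k + 1)})"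
proof -
  have plus: "{0, ivec x} + ivec ` A = ivec ` (A \<union> (\<lambda>y. x + y) ` A)" for x A
    by (auto simp: set_plus_def ivec_add image_Un image_image)
  have "izon [(0, 1), (1, 0), (1, k)] =
      convex hull ({0, ivec (0, 1)} + ({0, ivec (1, 0)} + ({0, ivec (1, k)} + ivec ` {(0, 0)})))"
    using ivec_0 by (simp add: zonotope_Cons segment_convex_hull convex_hull_set_plus zero_prod_def)
  also have "{0, ivec (0, 1)} + ({0, ivec (1, 0)} + ({0, ivec (1, k)} + ivec ` {(0, 0)})) =
      ivec ` {(0, 0), (0, 1), (1, 0), (1, 1), (1, k), (1, k + 1), (2, k), (2, k + 1)}"
    unfolding plus by (rule arg_cong[where f = "image ivec"]) auto
  finally show ?thesis .
qed

lemma extreme_point_of_exposed: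
  fixes v :: "'a::euclidean_space"
  assumes "finite S" "v \<in> S" "\<And>w. w \<in> S \<Longrightarrow> w \<noteq> v \<Longrightarrow> a \<bullet> v < a \<bullet> w"
  shows "v extreme_point_of (convex hull S)"
proof -
  have "convex hull (S - {v}) \<subseteq> {x. a \<bullet> x > a \<bullet> v}"
    using assms(3) by (intro hull_minimal convex_halfspace_gt) auto
  then have "v \<notin> convex hull (S - {v})" by auto
  then have "v extreme_point_of (convex hull (insert v (S - {v})))"
    using assms(1) by (intro extreme_point_of_convex_hull_insert) auto
  then show ?thesis using assms(2) by (simp add: insert_absorb)
qed

lemma hexagon_izon:
  assumes "k \<ge> 1"
  shows "hexagon (izon [(0, 1), (1, 0), (1, k)])"
proof -
  define S :: "(int \<times> int) set" where "S = {(0, 0), (0, 1), (1, 0), (1, 1), (1, k), (1, k + 1), (2, k), (2, k + 1)}"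
  define V :: "(int \<times> int) set" where "V = {(0, 0), (0, 1), (1, 0), (1, k + 1), (2, k), (2, k + 1)}"
  let ?P = "izon [(0, 1), (1, 0), (1, k)]"
  have P: "?P = convex hull (ivec ` S)" unfolding S_def by (rule izon_hexagon)
  have exposed: "ivec v extreme_point_of ?P"
    if "v \<in> S" "\<forall>w\<in>S. w \<noteq> v \<longrightarrow> fst a * fst v + snd a * snd v < fst a * fst w + snd a * snd w" for v a
    unfolding P
  proof (rule extreme_point_of_exposed[where a = "ivec a"])
    show "ivec a \<bullet> ivec v < ivec a \<bullet> w" if "w \<in> ivec ` S" "w \<noteq> ivec v" for w
      using that \<open>\<forall>w\<in>S. _ w\<close> unfolding inner_ivec by (auto simp: inner_ivec simp del: of_int_add of_int_mult)
  qed (use that S_def in auto)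
  \<comment> \<open>Each vertex is exposed as the unique minimiser of a functional. By central
    symmetry, opposite vertices use opposite directions.\<close>
  have "ivec (0, 0) extreme_point_of ?P" by (rule exposed[of _ "(1, 1)"]) (use assms in \<open>auto simp: S_def\<close>)
  moreover have "ivec (2, k + 1) extreme_point_of ?P"
    by (rule exposed[of _ "(- 1, - 1)"]) (use assms in \<open>auto simp: S_def\<close>)
  moreover have "ivec (0, 1) extreme_point_of ?P"
    by (rule exposed[of _ "(k + 1, - 1)"]) (use assms in \<open>auto simp: S_def\<close>)
  moreover have "ivec (2, k) extreme_point_of ?P"
    by (rule exposed[of _ "(- k - 1, 1)"]) (use assms in \<open>auto simp: S_def algebra_simps\<close>)
  moreover have "ivec (1, 0) extreme_point_of ?P"
    by (rule exposed[of _ "(- 1, 2)"]) (use assms in \<open>auto simp: S_def\<close>)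
  moreover have "ivec (1, k + 1) extreme_point_of ?P"
    by (rule exposed[of _ "(1, - 2)"]) (use assms in \<open>auto simp: S_def\<close>)
  ultimately have extreme: "x extreme_point_of ?P" if "x \<in> ivec ` V" for x
    using that by (auto simp: V_def)
  \<comment> \<open>The two remaining subset sums, (1, 1) and (1, k), lie strictly between the
    vertices (1, 0) and (1, k + 1); for k = 1 they coincide.\<close>
  have not_extreme: "\<not> ivec (1, j) extreme_point_of ?P" if "0 < j" "j < k + 1" for j
  proof
    assume *: "ivec (1, j) extreme_point_of ?P"
    define t where "t = real_of_int j / of_int (k + 1)"
    have t: "0 < t" "t < 1" "t * of_int (k + 1) = of_int j" using that by (auto simp: t_def)
    then have "ivec (1, j) = (1 - t) *\<^sub>R ivec (1, 0) + t *\<^sub>R ivec (1, k + 1)"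
      by (simp add: vec_eq_iff forall_2)
    moreover have "ivec (1, 0) \<noteq> ivec (1, k + 1)" using assms by (simp add: ivec_eq_iff)
    ultimately have "ivec (1, j) \<in> open_segment (ivec (1, 0)) (ivec (1, k + 1))"
      using t by (auto simp: in_segment)
    moreover have "ivec (1, 0) \<in> ?P" "ivec (1, k + 1) \<in> ?P"
      unfolding P by (rule hull_inc; simp add: S_def)+
    ultimately show False using * unfolding extreme_point_of_def by blast
  qed
  have "{v. v extreme_point_of ?P} = ivec ` V"
  proof
    show "{v. v extreme_point_of ?P} \<subseteq> ivec ` V"
    proof
      fix v assume v: "v \<in> {v. v extreme_point_of ?P}"
      then have "v \<in> ivec ` S" using extreme_point_of_convex_hull unfolding P by blast
      then obtain x where x: "x \<in> S" "v = ivec x" by blast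
      then have "x \<noteq> (1, 1)" "x \<noteq> (1, k)" using v not_extreme[of 1] not_extreme[of k] assms by auto
      then show "v \<in> ivec ` V" using x by (auto simp: S_def V_def)
    qed
  qed (use extreme in auto)
  moreover have "card (ivec ` V) = card V" by (rule card_image) (simp add: inj_on_def ivec_eq_iff)
  moreover have "card V = 6" using assms by (simp add: V_def)
  moreover have "polytope ?P"
    unfolding P by (intro polytope_convex_hull) (simp add: S_def)
  ultimately show ?thesis by (simp add: hexagon_def)
qed

lemma measure_parallelogram: "measure lebesgue (izon [x, y]) = \<bar>of_int (idet x y)\<bar>"
proof -
  define A :: "real ^ 2 ^ 2" where
    "A = vector [vector [of_int (fst x), of_int (fst y)], vector [of_int (snd x), of_int (snd y)]]"
  have A: "A *v p = p $ 1 *\<^sub>R ivec x + p $ 2 *\<^sub>R ivec y" for p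
    by (simp add: vec_eq_iff forall_2 A_def matrix_vector_mult_def sum_2 mult.commute)
  have "izon [x, y] = (*v) A ` cbox 0 1"
  proof
    show "izon [x, y] \<subseteq> (*v) A ` cbox 0 1"
    proof
      fix z assume "z \<in> izon [x, y]"
      then obtain s t where st: "0 \<le> s" "s \<le> 1" "0 \<le> t" "t \<le> 1" "z = s *\<^sub>R ivec x + t *\<^sub>R ivec y"
        by (auto elim!: zonotope_ConsE)
      then have "z = A *v vector [s, t]" by (simp add: A)
      moreover have "vector [s, t] \<in> cbox (0 :: real ^ 2) 1"
        using st by (simp add: mem_box_cart forall_2)
      ultimately show "z \<in> (*v) A ` cbox 0 1" by blast
    qed
    show "(*v) A ` cbox 0 1 \<subseteq> izon [x, y]"
    proof
      fix z assume "z \<in> (*v) A ` cbox 0 1"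
      then obtain p :: "real ^ 2" where "p \<in> cbox 0 1" "z = p $ 1 *\<^sub>R ivec x + (p $ 2 *\<^sub>R ivec y + 0)" by (auto simp: A)
      then show "z \<in> izon [x, y]"
        by (auto simp: mem_box_cart forall_2 intro!: zonotope_ConsI simp del: add_0_right)
    qed
  qed
  moreover have "(0 :: real ^ 2) \<in> cbox 0 1" by (simp add: mem_box_cart)
  then have "measure lebesgue (cbox 0 (1 :: real ^ 2)) = 1"
    using content_cbox_cart[of 0 "1 :: real ^ 2"] by auto
  moreover have "det A = of_int (idet x y)" by (simp add: A_def det_2 idet_def)
  ultimately show ?thesis
    using measure_linear_image[of "(*v) A" "cbox 0 1"] by simp
qed

section \<open>The classification\<close>

text \<open>A common normal vector serves two purposes: it bounds the affine dimension of the
  zonotope and shows that the generators do not span.\<close>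

lemma degenerate_generators:
  assumes "\<not> (\<exists>x\<in>set xs. \<exists>y\<in>set xs. idet x y \<noteq> 0)"
  obtains a where "a \<noteq> 0" "\<And>x. x \<in> set xs \<Longrightarrow> a \<bullet> ivec x = 0"
proof (cases "\<exists>x\<in>set xs. x \<noteq> 0")
  case True
  then obtain x where x: "x \<in> set xs" "x \<noteq> 0" by blast
  \<comment> \<open>The inner product with the quarter turn of \<open>x\<close> is
    \<open>idet x y\<close>.\<close>
  have "ivec (- snd x, fst x) \<bullet> ivec y = 0" if "y \<in> set xs" for y
    using assms x(1) that by (auto simp: inner_ivec idet_def algebra_simps)
  moreover have "ivec (- snd x, fst x) \<noteq> 0"
    using x(2) ivec_eq_iff[of "(- snd x, fst x)" 0] by (auto simp: ivec_0 prod_eq_iff)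
  ultimately show ?thesis using that by blast
next
  case False
  moreover have "ivec (1, 0) \<noteq> 0" by (simp add: vec_eq_iff forall_2)
  ultimately show ?thesis using that[of "ivec (1, 0)"] ivec_0 by (metis inner_zero_right)
qed

lemma zonotope_subset_hyperplane:
  assumes "\<And>u. u \<in> set us \<Longrightarrow> a \<bullet> u = 0"
  shows "zonotope us \<subseteq> {x. a \<bullet> x = 0}"
  using assms
proof (induction us)
  case (Cons u us)
  then show ?case by (auto simp: inner_add_right elim!: zonotope_ConsE)
qed simp

lemma aff_dim_izon_degenerate:
  assumes "\<not> (\<exists>x\<in>set xs. \<exists>y\<in>set xs. idet x y \<noteq> 0)"
  shows "aff_dim (izon xs) \<le> 1"
proof -
  obtain a where a: "a \<noteq> 0" "\<And>x. x \<in> set xs \<Longrightarrow> a \<bullet> ivec x = 0"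
    using degenerate_generators[OF assms] by blast
  have "aff_dim (izon xs) \<le> aff_dim {x. a \<bullet> x = 0}"
    using a(2) by (intro aff_dim_subset zonotope_subset_hyperplane) auto
  also have "\<dots> = 1" using a(1) by (simp add: aff_dim_hyperplane)
  finally show ?thesis .
qed

lemma span_degenerate:
  assumes "\<not> (\<exists>x\<in>set xs. \<exists>y\<in>set xs. idet x y \<noteq> 0)"
  shows "span (ivec ` set xs) \<noteq> UNIV"
proof
  assume span: "span (ivec ` set xs) = UNIV"
  obtain a where a: "a \<noteq> 0" "\<And>x. x \<in> set xs \<Longrightarrow> a \<bullet> ivec x = 0"
    using degenerate_generators[OF assms] by blast
  have "span (ivec ` set xs) \<subseteq> {x. a \<bullet> x = 0}"
    using a(2) by (intro span_minimal subspace_hyperplane) auto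
  then have "a \<in> {x. a \<bullet> x = 0}" using span by blast
  then show False using a(1) by simp
qed

lemma lattice_list:
  assumes "set us \<subseteq> int_lattice"
  obtains xs where "us = map ivec xs"
  using assms unfolding int_lattice_2 by (metis ex_map_conv subset_iff rangeE)

lemma det_ivec: "det (vector [ivec x, ivec y] :: real ^ 2 ^ 2) = of_int (idet x y)"
  by (simp add: det_2 idet_def)

lemma noncovering_normal_form:
  assumes "0 \<notin> set xs" "\<exists>x\<in>set xs. \<exists>y\<in>set xs. idet x y \<noteq> 0" "\<not> half_covers (izon xs)"
  shows "(\<exists>k\<ge>1. unimodularly_equivalent (izon xs) (izon [(1, 0), (0, k)])) \<or>
    (\<exists>k\<ge>2. unimodularly_equivalent (izon xs) (izon [(1, 0), (1, k)])) \<or>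
    (\<exists>k\<ge>1. unimodularly_equivalent (izon xs) (izon [(0, 1), (1, 0), (1, k)])) \<or>
    unimodularly_equivalent (izon xs) (izon [(1, 0), (2, 5)])"
  using assms
proof (cases rule: noncovering_cases)
  case (strip v w M)
  have "M \<noteq> {#}"
  proof
    assume "M = {#}"
    then have "set xs = {w}" using strip(1) by (metis set_mset_mset set_mset_single)
    then show False using assms(2) by simp
  qed
  moreover have "0 \<notin># M" using assms(1) strip(1) by (metis set_mset_mset insertI2 set_mset_add_mset_insert)
  ultimately obtain k where "k \<ge> 1" "unimodularly_equivalent (izon xs) (izon [(1, 0), (0, k)])"
    using strip_equivalent[OF strip] by blast
  then show ?thesis by blast
next
  case (width_2 u w e k)
  then have "unimodularly_equivalent (izon xs) (izon [(1, 0), (1, k)])"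
    by (intro parallelogram_equivalent[OF width_2(1,2)]) (simp add: iscale_simps)
  then show ?thesis using width_2(3) by blast
next
  case (hexagon u w x)
  have "\<bar>idet u w\<bar> \<ge> 1" using hexagon(4) by simp
  then show ?thesis using hexagon_equivalent[OF hexagon] by blast
next
  case (width_3 u w e)
  then show ?thesis using parallelogram_equivalent[OF width_3] by blast
qed

lemma lattice_2_zonotope_classification:
  assumes Z: "lattice_2_zonotope Z" and "covering_radius Z > 1 / 2"
  obtains xs where "unimodularly_equivalent Z (izon xs)"
    "(\<exists>k\<ge>1. xs = [(1, 0), (0, k)]) \<or> (\<exists>k\<ge>2. xs = [(1, 0), (1, k)]) \<or>
     (\<exists>k\<ge>1. xs = [(0, 1), (1, 0), (1, k)]) \<or> xs = [(1, 0), (2, 5)]"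
proof -
  obtain us t where us: "set us \<subseteq> int_lattice" "t \<in> int_lattice" "Z = (\<lambda>x. x + t) ` zonotope us"
    using Z by (auto simp: lattice_2_zonotope_def lattice_zonotope_def)
  obtain ys where ys: "us = map ivec ys" using lattice_list[OF us(1)] .
  define xs where "xs = filter (\<lambda>x. x \<noteq> 0) ys"
  have Z_xs: "Z = (\<lambda>x. x + t) ` izon xs" by (simp add: us(3) ys xs_def izon_filter_nonzero)
  have "\<not> half_covers Z" using covering_radius_le_half[of Z] assms(2) by auto
  then have not_covers: "\<not> half_covers (izon xs)" using half_covers_translation Z_xs by blast
  have "aff_dim (izon xs) = 2"
    using Z aff_dim_translation_eq[of t "izon xs"] by (simp add: lattice_2_zonotope_def Z_xs add.commute)
  then have span: "\<exists>x\<in>set xs. \<exists>y\<in>set xs. idet x y \<noteq> 0" using aff_dim_izon_degenerate by fastforce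
  have equiv: "unimodularly_equivalent Z (izon xs)"
    unfolding Z_xs by (rule unimodularly_equivalent_translation[OF us(2)])
  have "0 \<notin> set xs" by (simp add: xs_def)
  from noncovering_normal_form[OF this span not_covers] show ?thesis
    using that unimodularly_equivalent_trans[OF equiv] by blast
qed

section \<open>Coefficients of a dependence attached to generators\<close>

lemma image_mset_fst_add_mset:
  assumes "image_mset fst A = add_mset x M"
  obtains t N where "A = add_mset (x, t) N" "image_mset fst N = M"
  using msed_map_invR[OF assms] by auto

text \<open>Two occurrences in the multiset stand for two different list positions, so their values
  differ even if nothing is known about \<open>p\<close> and \<open>q\<close> themselves.\<close>

lemma distinct_map_mset:
  assumes "distinct (map f xs)" "mset xs = add_mset p (add_mset q N)"
  shows "f p \<noteq> f q"
proof
  assume "f p = f q"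
  then have "count (mset (map f xs)) (f p) \<ge> 2" using assms(2) by simp
  then show False using assms(1) by (simp add: distinct_count_atmost_1 split: if_splits)
qed

text \<open>In each non-covering configuration, pairing the dependence with a suitable direction by
  means of the determinant leaves at most two terms.\<close>

lemma cosimple_half_covers:
  assumes "cosimple us"
  shows "half_covers (zonotope us :: (real ^ 2) set)"
proof (rule ccontr)
  assume not_covers: "\<not> half_covers (zonotope us)"
  obtain c :: "nat \<Rightarrow> real" where lattice: "set us \<subseteq> int_lattice" and span: "span (set us) = UNIV"
    and c: "(\<Sum>i<length us. c i *\<^sub>R us ! i) = 0" "\<And>i. i < length us \<Longrightarrow> c i \<noteq> 0"
      "inj_on (\<lambda>i. \<bar>c i\<bar>) {..<length us}"
    using assms by (auto simp: cosimple_def)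
  obtain xs where xs: "us = map ivec xs" using lattice_list[OF lattice] .
  \<comment> \<open>Pairing each generator with its coefficient lets the case analysis on multisets
    keep track of coefficients. Zero generators are dropped, which changes neither the zonotope nor
    the dependence.\<close>
  define zs where "zs = filter (\<lambda>z. fst z \<noteq> 0) (zip xs (map c [0..<length xs]))"
  have fst_zs: "map fst zs = filter (\<lambda>x. x \<noteq> 0) xs"
    using filter_map[of "\<lambda>x. x \<noteq> 0" fst "zip xs (map c [0..<length xs])"] by (simp add: zs_def o_def)
  have coeff: "t \<noteq> 0" if "(x, t) \<in># mset zs" for x t
    using that c(2) by (auto simp: zs_def xs in_set_zip)
  have "distinct (map (\<lambda>z. \<bar>snd z\<bar>) (zip xs (map c [0..<length xs])))"
  proof -
    have "map (\<lambda>z. \<bar>snd z\<bar>) (zip xs (map c [0..<length xs])) = map (\<lambda>i. \<bar>c i\<bar>) [0..<length xs]"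
      by (rule nth_equalityI) auto
    then show ?thesis using c(3) by (simp add: distinct_map xs atLeast0LessThan)
  qed
  then have distinct: "distinct (map (\<lambda>z. \<bar>snd z\<bar>) zs)" unfolding zs_def by (rule distinct_map_filter)
  \<comment> \<open>The functional \<open>idet v\<close> applied to the dependence; it is the inner
    product with the quarter turn of \<open>v\<close>.\<close>
  have dep: "(\<Sum>z\<in>#mset zs. snd z * of_int (idet v (fst z))) = 0" for v
  proof -
    have "0 = ivec (- snd v, fst v) \<bullet> (\<Sum>i<length xs. c i *\<^sub>R ivec (xs ! i))"
      using c(1) by (simp add: xs)
    also have "\<dots> = (\<Sum>i<length xs. c i * of_int (idet v (xs ! i)))"
      by (simp add: inner_sum_right inner_ivec idet_def algebra_simps)
    also have "\<dots> = (\<Sum>z\<leftarrow>zip xs (map c [0..<length xs]). snd z * of_int (idet v (fst z)))"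
      by (simp add: sum_list_sum_nth atLeast0LessThan)
    also have "\<dots> = (\<Sum>z\<leftarrow>zs. snd z * of_int (idet v (fst z)))"
      unfolding zs_def by (rule sum_list_map_filter[symmetric]) auto
    finally show ?thesis by (simp add: sum_mset_sum_list flip: mset_map)
  qed
  \<comment> \<open>Pairing with \<open>u\<close> leaves only the coefficient of \<open>w\<close>
    times a nonzero determinant.\<close>
  have no_pair: False if pair: "mset (map fst zs) = {#u, w#}" and det: "idet u w \<noteq> 0" for u w
  proof -
    obtain s M where M: "mset zs = add_mset (u, s) M" "image_mset fst M = add_mset w {#}"
      using pair[unfolded mset_map] by (rule image_mset_fst_add_mset)
    from M(2) obtain t where "M = {#(w, t)#}" by (rule image_mset_fst_add_mset) simp
    then show False using dep[of u] coeff[of w t] M(1) det by simp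
  qed
  have "izon (map fst zs) = zonotope us" by (simp add: fst_zs izon_filter_nonzero xs)
  then have zs_not_covers: "\<not> half_covers (izon (map fst zs))" using not_covers by simp
  have "\<exists>x\<in>set xs. \<exists>y\<in>set xs. idet x y \<noteq> 0"
    using span span_degenerate[of xs] by (auto simp: xs)
  then have zs_span: "\<exists>x\<in>set (map fst zs). \<exists>y\<in>set (map fst zs). idet x y \<noteq> 0"
    unfolding fst_zs by (auto, metis idet_simps(2,3))
  have "0 \<notin> set (map fst zs)" unfolding fst_zs by simp
  then show False
    using zs_span zs_not_covers
  proof (cases rule: noncovering_cases)
    case (strip v w M)
    then have "image_mset fst (mset zs) = add_mset w M" by simp
    then obtain t N where N: "mset zs = add_mset (w, t) N" "image_mset fst N = M"
      by (rule image_mset_fst_add_mset)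
    have "(\<Sum>z\<in>#N. snd z * of_int (idet v (fst z))) = 0"
    proof (intro sum_mset.neutral ballI)
      fix y assume "y \<in># image_mset (\<lambda>z. snd z * real_of_int (idet v (fst z))) N"
      then obtain z where z: "z \<in># N" "y = snd z * of_int (idet v (fst z))" by auto
      then have "idet v (fst z) = 0" using N(2) by (intro strip(3)) auto
      then show "y = 0" using z(2) by simp
    qed
    then have "t * of_int (idet v w) = 0" using dep[of v] N(1) by simp
    then show False using strip(2) coeff[of w t] N(1) by auto
  next
    case (width_2 u w e k)
    then have "idet u w \<noteq> 0" by auto
    then show False by (rule no_pair[OF width_2(1)])
  next
    case (hexagon u w x)
    then have "image_mset fst (mset zs) = add_mset u {#w, x#}" by simp
    then obtain s M where M: "mset zs = add_mset (u, s) M" "image_mset fst M = add_mset w {#x#}"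
      by (rule image_mset_fst_add_mset)
    from M(2) obtain t N where N: "M = add_mset (w, t) N" "image_mset fst N = {#x#}"
      by (rule image_mset_fst_add_mset)
    from N(2) obtain r where r: "N = {#(x, r)#}"
      by (rule image_mset_fst_add_mset) simp
    \<comment> \<open>Pairing with \<open>x\<close> eliminates \<open>x\<close>. The two remaining
      determinants are 1 in absolute value, so the coefficients of \<open>u\<close> and
      \<open>w\<close> would agree in absolute value.\<close>
    have "s * of_int (idet x u) = - (t * of_int (idet x w))"
      using dep[of x] by (simp add: M(1) N(1) r)
    then have "\<bar>s\<bar> * of_int \<bar>idet x u\<bar> = \<bar>t\<bar> * of_int \<bar>idet x w\<bar>"
      by (metis abs_minus_cancel abs_mult of_int_abs)
    then have "\<bar>s\<bar> = \<bar>t\<bar>" using hexagon(2,3) by (simp add: idet_commute[of x])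
    moreover have "\<bar>s\<bar> \<noteq> \<bar>t\<bar>"
      using distinct_map_mset[OF distinct, of "(u, s)" "(w, t)"] M(1) N(1) by auto
    ultimately show False by contradiction
  next
    case (width_3 u w e)
    then have "idet u w \<noteq> 0" by auto
    then show False by (rule no_pair[OF width_3(1)])
  qed
qed

theorem theorem6p3:
  shows "(\<forall>Z :: (real ^ 2) set. lattice_2_zonotope Z \<and> covering_radius Z > 1 / 2 \<longrightarrow>
      (\<exists>Q. unimodularly_equivalent Z Q \<and>
        ((\<exists>k::int. k \<ge> 1 \<and> Q = zonotope [vector [1, 0], vector [0, of_int k]] \<and>
            lattice_width Q = 1)
         \<or> (\<exists>k::int. k \<ge> 2 \<and> Q = P_par 1 k \<and> lattice_width Q = 2 \<and>
            measure lebesgue Q = of_int k)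
         \<or> (\<exists>(k::int) u1 u2 u3. k \<ge> 1 \<and> {u1, u2, u3} \<subseteq> int_lattice \<and>
            Q = zonotope [u1, u2, u3] \<and> hexagon Q \<and> lattice_width Q = 2 \<and>
            volume_vector u1 u2 u3 = {# 1, 1, of_int k #})
         \<or> (Q = P_par 2 5 \<and> lattice_width Q = 3 \<and> measure lebesgue Q = 5))))
    \<and> (\<forall>us :: (real ^ 2) list. cosimple us \<longrightarrow> covering_radius (zonotope us) \<le> 1 / 2)"
proof (intro conjI allI impI)
  fix us :: "(real ^ 2) list" assume "cosimple us"
  then show "covering_radius (zonotope us) \<le> 1 / 2"
    by (intro covering_radius_le_half cosimple_half_covers)
next
  fix Z :: "(real ^ 2) set" assume Z: "lattice_2_zonotope Z \<and> covering_radius Z > 1 / 2"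
  then obtain xs where equiv: "unimodularly_equivalent Z (izon xs)" and
    cases: "(\<exists>k\<ge>1. xs = [(1, 0), (0, k)]) \<or> (\<exists>k\<ge>2. xs = [(1, 0), (1, k)]) \<or>
     (\<exists>k\<ge>1. xs = [(0, 1), (1, 0), (1, k)]) \<or> xs = [(1, 0), (2, 5)]"
    using lattice_2_zonotope_classification by blast
  have P_par: "P_par p q = izon [(1, 0), (p, q)]" for p q
    by (simp add: P_par_def ivec_def)
  show "\<exists>Q. unimodularly_equivalent Z Q \<and>
        ((\<exists>k::int. k \<ge> 1 \<and> Q = zonotope [vector [1, 0], vector [0, of_int k]] \<and>
            lattice_width Q = 1)
         \<or> (\<exists>k::int. k \<ge> 2 \<and> Q = P_par 1 k \<and> lattice_width Q = 2 \<and>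
            measure lebesgue Q = of_int k)
         \<or> (\<exists>(k::int) u1 u2 u3. k \<ge> 1 \<and> {u1, u2, u3} \<subseteq> int_lattice \<and>
            Q = zonotope [u1, u2, u3] \<and> hexagon Q \<and> lattice_width Q = 2 \<and>
            volume_vector u1 u2 u3 = {# 1, 1, of_int k #})
         \<or> (Q = P_par 2 5 \<and> lattice_width Q = 3 \<and> measure lebesgue Q = 5))"
  proof (rule exI[of _ "izon xs"], rule conjI[OF equiv])
    consider k where "k \<ge> 1" "xs = [(1, 0), (0, k)]" | k where "k \<ge> 2" "xs = [(1, 0), (1, k)]"
      | k where "k \<ge> 1" "xs = [(0, 1), (1, 0), (1, k)]" | "xs = [(1, 0), (2, 5)]"
      using cases by blast
    then show "(\<exists>k::int. k \<ge> 1 \<and> izon xs = zonotope [vector [1, 0], vector [0, of_int k]] \<and>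
            lattice_width (izon xs) = 1)
         \<or> (\<exists>k::int. k \<ge> 2 \<and> izon xs = P_par 1 k \<and> lattice_width (izon xs) = 2 \<and>
            measure lebesgue (izon xs) = of_int k)
         \<or> (\<exists>(k::int) u1 u2 u3. k \<ge> 1 \<and> {u1, u2, u3} \<subseteq> int_lattice \<and>
            izon xs = zonotope [u1, u2, u3] \<and> hexagon (izon xs) \<and> lattice_width (izon xs) = 2 \<and>
            volume_vector u1 u2 u3 = {# 1, 1, of_int k #})
         \<or> (izon xs = P_par 2 5 \<and> lattice_width (izon xs) = 3 \<and> measure lebesgue (izon xs) = 5)"
    proof cases
      case (1 k)
      have "izon xs = zonotope [vector [1, 0], vector [0, of_int k]]" by (simp add: 1(2) ivec_def)
      then show ?thesis using lattice_width_strip[OF 1(1)] 1 by blast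
    next
      case (2 k)
      have "measure lebesgue (izon xs) = of_int k"
        using measure_parallelogram[of "(1, 0)" "(1, k)"] 2 by (simp add: idet_def)
      then show ?thesis using lattice_width_P_1[OF 2(1)] 2 P_par by blast
    next
      case (3 k)
      have "volume_vector (ivec (0, 1)) (ivec (1, 0)) (ivec (1, k)) = {# 1, 1, of_int k #}"
        using 3(1) by (simp add: volume_vector_def det_ivec idet_def)
      moreover have "{ivec (0, 1), ivec (1, 0), ivec (1, k)} \<subseteq> int_lattice"
        by (simp add: int_lattice_2)
      moreover have "izon xs = zonotope [ivec (0, 1), ivec (1, 0), ivec (1, k)]" by (simp add: 3(2))
      ultimately show ?thesis
        using 3 hexagon_izon[OF 3(1)] lattice_width_hexagon[OF 3(1)] by blast
    next
      case 4
      have "measure lebesgue (izon xs) = 5"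
        using measure_parallelogram[of "(1, 0)" "(2, 5)"] 4 by (simp add: idet_def)
      then show ?thesis using lattice_width_P_2_5 4 P_par by blast
    qed
  qed
qed

end
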